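(* Let $S$ be a semiring. Each of the following conditions implies its successor, i.e. $(1)\Rightarrow(2)\Rightarrow(3)\Rightarrow(4)\Rightarrow(5)\Rightarrow(6)\Rightarrow(7)\Rightarrow(8)$: (1) Every subtractive left ideal of $S$ is a direct summand of $S$ (as a left $S$-semimodule). (2) Every left $S$-semimodule is $S$-$e$-projective. (3) Every left $S$-semimodule is $S$-$k$-projective. (4) $S/I$ is $S$-$k$-projective for every subtractive left ideal $I$ of $S$. (5) Every short exact sequence $0\to I\to S\to N\to 0$ of left $S$-semimodules right splits. (6) $S$, as a left $S$-semimodule, satisfies the ascending chain condition (ACC) on direct summands. (7) $S$, as a left $S$-semimodule, satisfies the descending chain condition (DCC) on direct summands. (8) $S=S_1\oplus\cdots\oplus S_n$ for some $n$, where every $S_i$ is an irreducible summand of $S$ (as a left $S$-semimodule).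
   Context: A semiring $(S,+,0,\cdot,1)$ consists of a commutative monoid $(S,+,0)$ and a monoid $(S,\cdot,1)$ with $0\neq 1$, $a\cdot 0=0=0\cdot a$, and both distributive laws. Left $S$-semimodules (commutative monoids with a unital, biadditive $S$-action satisfying $s0=0$ and $0m=0$), $S$-linear maps and subsemimodules are defined as for modules over rings, without requiring additive inverses. Left ideals of $S$ are the subsemimodules of $S$ regarded as a left $S$-semimodule. For a subsemimodule $L$ of $M$, $\overline{L}=\{m\in M\mid m+l=l' \text{ for some } l,l'\in L\}$; $L$ is subtractive if $L=\overline{L}$. The quotient $M/L$ is $M/{\equiv_L}$, where $m\equiv_L m'$ iff $m+l=m'+l'$ for some $l,l'\in L$. $M=\bigoplus_{\lambda}L_\lambda$ means that every $m\in M$ can be written in a unique way as a finite sum of elements of the subsemimodules $L_\lambda$. $N$ is a direct summand of $M$ if $M=N\oplus N'$ for some subsemimodule $N'$. A maximal summand of $M$ is a direct summand $N\neq M$ such that every direct summand $L$ of $M$ with $N\subseteq L\subseteq M$ satisfies $L=N$ or $L=M$. A direct summand $N$ of $M$ is an irreducible summand if $\{0\}$ is a maximal summand of $N$. ACC (resp. DCC) on direct summands means every ascending (resp. descending) chain of direct summands terminates. An $S$-linear map $f:L\to M$ is $k$-normal if $f(m)=f(m')$ implies $m+k=m'+k'$ for some $k,k'\in \mathrm{Ker}(f)$; it is $i$-normal if $f(L)=\overline{f(L)}$; it is normal if it is both. A short exact sequence $0\to L\xrightarrow{f}M\xrightarrow{g}N\to 0$ is one with $f$ injective, $f(L)=\mathrm{Ker}(g)$,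 and $g$ surjective and $k$-normal. It is right splitting (right splits) if there is an $S$-linear $g':N\to M$ with $g\circ g'=\mathrm{id}_N$. A left $S$-semimodule $P$ is $M$-$e$-projective if $\mathrm{Hom}_S(P,-)$ transfers every short exact sequence $0\to L\to M\to N\to 0$ of left $S$-semimodules (with the given middle term $M$) into a short exact sequence $0\to \mathrm{Hom}_S(P,L)\to \mathrm{Hom}_S(P,M)\to \mathrm{Hom}_S(P,N)\to 0$ of commutative monoids (i.e. semimodules over the semiring of non-negative integers). $P$ is $M$-$k$-projective if for every normal surjective $S$-linear map $f:M\to N$ and every $S$-linear map $g:P\to N$ there is an $S$-linear $h:P\to M$ with $f\circ h=g$. "$S$-$e$-projective" and "$S$-$k$-projective" refer to $M=S$ as a left $S$-semimodule. *)

theory Defs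
  imports "HOL-Algebra.AbelCoset" "HOL-Algebra.Module"
begin

text \<open>
  Semimodules reuse the library record \<^typ>\<open>('a, 'b) module\<close>; as for library modules, its
  multiplicative fields are ignored.  The library locale \<^locale>\<open>semiring\<close> does not require
  \<open>\<zero> \<noteq> \<one>\<close>, so this is assumed separately where it is needed.
\<close>

locale left_semimodule = R?: semiring R + M?: abelian_monoid M
  for R :: "('a, 'r) ring_scheme" (structure) and M :: "('a, 'b, 'm) module_scheme" (structure) +
  assumes smult_closed:
      "\<lbrakk>a \<in> carrier R; x \<in> carrier M\<rbrakk> \<Longrightarrow> a \<odot>\<^bsub>M\<^esub> x \<in> carrier M"
    and smult_l_distr:
      "\<lbrakk>a \<in> carrier R; b \<in> carrier R; x \<in> carrier M\<rbrakk>
        \<Longrightarrow> (a \<oplus> b) \<odot>\<^bsub>M\<^esub> x = a \<odot>\<^bsub>M\<^esub> x \<oplus>\<^bsub>M\<^esub> b \<odot>\<^bsub>M\<^esub> x"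
    and smult_r_distr:
      "\<lbrakk>a \<in> carrier R; x \<in> carrier M; y \<in> carrier M\<rbrakk>
        \<Longrightarrow> a \<odot>\<^bsub>M\<^esub> (x \<oplus>\<^bsub>M\<^esub> y) = a \<odot>\<^bsub>M\<^esub> x \<oplus>\<^bsub>M\<^esub> a \<odot>\<^bsub>M\<^esub> y"
    and smult_assoc:
      "\<lbrakk>a \<in> carrier R; b \<in> carrier R; x \<in> carrier M\<rbrakk>
        \<Longrightarrow> (a \<otimes> b) \<odot>\<^bsub>M\<^esub> x = a \<odot>\<^bsub>M\<^esub> (b \<odot>\<^bsub>M\<^esub> x)"
    and smult_one: "x \<in> carrier M \<Longrightarrow> \<one> \<odot>\<^bsub>M\<^esub> x = x"
    and smult_zero_right: "a \<in> carrier R \<Longrightarrow> a \<odot>\<^bsub>M\<^esub> \<zero>\<^bsub>M\<^esub> = \<zero>\<^bsub>M\<^esub>"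
    and smult_zero_left: "x \<in> carrier M \<Longrightarrow> \<zero> \<odot>\<^bsub>M\<^esub> x = \<zero>\<^bsub>M\<^esub>"

definition regular_semimodule :: "('a, 'r) ring_scheme \<Rightarrow> ('a, 'a) module" where
  "regular_semimodule R =
     \<lparr>carrier = carrier R, mult = mult R, one = one R, zero = zero R, add = add R,
      smult = mult R\<rparr>"

definition subsemimodule ::
    "('a, 'r) ring_scheme \<Rightarrow> 'b set \<Rightarrow> ('a, 'b, 'm) module_scheme \<Rightarrow> bool" where
  "subsemimodule R L M \<longleftrightarrow>
     L \<subseteq> carrier M \<and> \<zero>\<^bsub>M\<^esub> \<in> L \<and>
     (\<forall>x\<in>L. \<forall>y\<in>L. x \<oplus>\<^bsub>M\<^esub> y \<in> L) \<and>
     (\<forall>a\<in>carrier R. \<forall>x\<in>L. a \<odot>\<^bsub>M\<^esub> x \<in> L)"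

definition left_ideal :: "('a, 'r) ring_scheme \<Rightarrow> 'a set \<Rightarrow> bool" where
  "left_ideal R I \<longleftrightarrow> subsemimodule R I (regular_semimodule R)"

definition subtractive_closure :: "('a, 'b, 'm) module_scheme \<Rightarrow> 'b set \<Rightarrow> 'b set" where
  "subtractive_closure M L = {m \<in> carrier M. \<exists>l\<in>L. \<exists>l'\<in>L. m \<oplus>\<^bsub>M\<^esub> l = l'}"

definition subtractive :: "('a, 'b, 'm) module_scheme \<Rightarrow> 'b set \<Rightarrow> bool" where
  "subtractive M L \<longleftrightarrow> L = subtractive_closure M L"

definition quotient_rel :: "('a, 'b, 'm) module_scheme \<Rightarrow> 'b set \<Rightarrow> ('b \<times> 'b) set" where
  "quotient_rel M L =
     {(m, m') \<in> carrier M \<times> carrier M. \<exists>l\<in>L. \<exists>l'\<in>L. m \<oplus>\<^bsub>M\<^esub> l = m' \<oplus>\<^bsub>M\<^esub> l'}"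

text \<open>
  The operations are induced from representatives: each union below is taken over copies of one
  and the same equivalence class.
\<close>

definition quotient_semimodule ::
    "('a, 'b, 'm) module_scheme \<Rightarrow> 'b set \<Rightarrow> ('a, 'b set) module" where
  "quotient_semimodule M L =
     \<lparr>carrier = carrier M // quotient_rel M L, mult = undefined, one = undefined,
      zero = quotient_rel M L `` {\<zero>\<^bsub>M\<^esub>},
      add = (\<lambda>A B. \<Union>x\<in>A. \<Union>y\<in>B. quotient_rel M L `` {x \<oplus>\<^bsub>M\<^esub> y}),
      smult = (\<lambda>a A. \<Union>x\<in>A. quotient_rel M L `` {a \<odot>\<^bsub>M\<^esub> x})\<rparr>"

text \<open>
  A finite sum of elements of the \<open>L i\<close> is encoded as a family of finite support, so that
  uniqueness is taken up to order and zero summands.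
\<close>

definition is_direct_sum ::
    "('a, 'r) ring_scheme \<Rightarrow> ('a, 'b, 'm) module_scheme \<Rightarrow> 'i set \<Rightarrow> ('i \<Rightarrow> 'b set) \<Rightarrow> bool" where
  "is_direct_sum R M I L \<longleftrightarrow>
     (\<forall>i\<in>I. subsemimodule R (L i) M) \<and>
     (\<forall>m\<in>carrier M. \<exists>!x. x \<in> (\<Pi>\<^sub>E i\<in>I. L i) \<and> finite {i\<in>I. x i \<noteq> \<zero>\<^bsub>M\<^esub>} \<and>
        m = finsum M x {i\<in>I. x i \<noteq> \<zero>\<^bsub>M\<^esub>})"

definition direct_summand ::
    "('a, 'r) ring_scheme \<Rightarrow> 'b set \<Rightarrow> ('a, 'b, 'm) module_scheme \<Rightarrow> bool" where
  "direct_summand R N M \<longleftrightarrow>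
     (\<exists>N'. is_direct_sum R M (UNIV :: bool set) (\<lambda>b. if b then N else N'))"

definition maximal_summand ::
    "('a, 'r) ring_scheme \<Rightarrow> 'b set \<Rightarrow> ('a, 'b, 'm) module_scheme \<Rightarrow> bool" where
  "maximal_summand R N M \<longleftrightarrow>
     direct_summand R N M \<and> N \<noteq> carrier M \<and>
     (\<forall>L. direct_summand R L M \<and> N \<subseteq> L \<and> L \<subseteq> carrier M \<longrightarrow> L = N \<or> L = carrier M)"

definition irreducible_summand ::
    "('a, 'r) ring_scheme \<Rightarrow> 'b set \<Rightarrow> ('a, 'b, 'm) module_scheme \<Rightarrow> bool" where
  "irreducible_summand R N M \<longleftrightarrow>
     direct_summand R N M \<and> maximal_summand R {\<zero>\<^bsub>M\<^esub>} (M\<lparr>carrier := N\<rparr>)"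

definition acc_direct_summands ::
    "('a, 'r) ring_scheme \<Rightarrow> ('a, 'b, 'm) module_scheme \<Rightarrow> bool" where
  "acc_direct_summands R M \<longleftrightarrow>
     (\<forall>N :: nat \<Rightarrow> 'b set. (\<forall>i. direct_summand R (N i) M) \<and> (\<forall>i. N i \<subseteq> N (Suc i))
        \<longrightarrow> (\<exists>n. \<forall>i\<ge>n. N i = N n))"

definition dcc_direct_summands ::
    "('a, 'r) ring_scheme \<Rightarrow> ('a, 'b, 'm) module_scheme \<Rightarrow> bool" where
  "dcc_direct_summands R M \<longleftrightarrow>
     (\<forall>N :: nat \<Rightarrow> 'b set. (\<forall>i. direct_summand R (N i) M) \<and> (\<forall>i. N (Suc i) \<subseteq> N i)
        \<longrightarrow> (\<exists>n. \<forall>i\<ge>n. N i = N n))"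

definition linear_maps ::
    "('a, 'r) ring_scheme \<Rightarrow> ('a, 'b, 'm) module_scheme \<Rightarrow> ('a, 'c, 'n) module_scheme
      \<Rightarrow> ('b \<Rightarrow> 'c) set" where
  "linear_maps R M N =
     {f. f \<in> carrier M \<rightarrow> carrier N \<and>
         (\<forall>x\<in>carrier M. \<forall>y\<in>carrier M. f (x \<oplus>\<^bsub>M\<^esub> y) = f x \<oplus>\<^bsub>N\<^esub> f y) \<and>
         (\<forall>a\<in>carrier R. \<forall>x\<in>carrier M. f (a \<odot>\<^bsub>M\<^esub> x) = a \<odot>\<^bsub>N\<^esub> f x)}"

definition k_normal ::
    "('a, 'b, 'm) module_scheme \<Rightarrow> ('a, 'c, 'n) module_scheme \<Rightarrow> ('b \<Rightarrow> 'c) \<Rightarrow> bool" where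
  "k_normal M N f \<longleftrightarrow>
     (\<forall>m\<in>carrier M. \<forall>m'\<in>carrier M. f m = f m' \<longrightarrow>
        (\<exists>k\<in>a_kernel M N f. \<exists>k'\<in>a_kernel M N f. m \<oplus>\<^bsub>M\<^esub> k = m' \<oplus>\<^bsub>M\<^esub> k'))"

definition i_normal ::
    "('a, 'b, 'm) module_scheme \<Rightarrow> ('a, 'c, 'n) module_scheme \<Rightarrow> ('b \<Rightarrow> 'c) \<Rightarrow> bool" where
  "i_normal M N f \<longleftrightarrow> f ` carrier M = subtractive_closure N (f ` carrier M)"

definition normal_map ::
    "('a, 'b, 'm) module_scheme \<Rightarrow> ('a, 'c, 'n) module_scheme \<Rightarrow> ('b \<Rightarrow> 'c) \<Rightarrow> bool" where
  "normal_map M N f \<longleftrightarrow> k_normal M N f \<and> i_normal M N f"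

definition short_exact ::
    "('a, 'r) ring_scheme \<Rightarrow> ('a, 'b, 'l) module_scheme \<Rightarrow> ('a, 'c, 'm) module_scheme
      \<Rightarrow> ('a, 'd, 'n) module_scheme \<Rightarrow> ('b \<Rightarrow> 'c) \<Rightarrow> ('c \<Rightarrow> 'd) \<Rightarrow> bool" where
  "short_exact R L M N f g \<longleftrightarrow>
     left_semimodule R L \<and> left_semimodule R M \<and> left_semimodule R N \<and>
     f \<in> linear_maps R L M \<and> g \<in> linear_maps R M N \<and>
     inj_on f (carrier L) \<and> f ` carrier L = a_kernel M N g \<and>
     g ` carrier M = carrier N \<and> k_normal M N g"

definition right_splits ::
    "('a, 'r) ring_scheme \<Rightarrow> ('a, 'c, 'm) module_scheme \<Rightarrow> ('a, 'd, 'n) module_scheme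
      \<Rightarrow> ('c \<Rightarrow> 'd) \<Rightarrow> bool" where
  "right_splits R M N g \<longleftrightarrow>
     (\<exists>g'\<in>linear_maps R N M. \<forall>y\<in>carrier N. g (g' y) = y)"

definition nat_semiring :: "nat ring" where
  "nat_semiring = \<lparr>carrier = UNIV, mult = (*), one = 1, zero = 0, add = (+)\<rparr>"

text \<open>
  \<open>Hom\<^sub>R(P, M)\<close> as a semimodule over the natural numbers, with pointwise operations.  Restricting
  to extensional functions makes equality of functions coincide with equality of maps on
  \<open>carrier P\<close>.
\<close>

definition Hom_semimodule ::
    "('a, 'r) ring_scheme \<Rightarrow> ('a, 'p, 'n) module_scheme \<Rightarrow> ('a, 'b, 'm) module_scheme
      \<Rightarrow> (nat, 'p \<Rightarrow> 'b) module" where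
  "Hom_semimodule R P M =
     \<lparr>carrier = linear_maps R P M \<inter> extensional (carrier P), mult = undefined, one = undefined,
      zero = (\<lambda>p\<in>carrier P. \<zero>\<^bsub>M\<^esub>),
      add = (\<lambda>h h'. \<lambda>p\<in>carrier P. h p \<oplus>\<^bsub>M\<^esub> h' p),
      smult = (\<lambda>n h. \<lambda>p\<in>carrier P. [n] \<cdot>\<^bsub>M\<^esub> h p)\<rparr>"

text \<open>
  HOL cannot quantify over all types inside a formula.  The argument of type \<open>'u itself\<close> fixes
  the type \<open>'u\<close> in which the carriers of the quantified semimodules are taken.
\<close>

definition e_projective ::
    "'u itself \<Rightarrow> ('a, 'r) ring_scheme \<Rightarrow> ('a, 'b, 'm) module_scheme
      \<Rightarrow> ('a, 'p, 'n) module_scheme \<Rightarrow> bool" where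
  "e_projective (_ :: 'u itself) R M P \<longleftrightarrow>
     (\<forall>(L :: ('a, 'u) module) (N :: ('a, 'u) module) f g.
        short_exact R L M N f g \<longrightarrow>
        short_exact nat_semiring (Hom_semimodule R P L) (Hom_semimodule R P M)
          (Hom_semimodule R P N) (compose (carrier P) f) (compose (carrier P) g))"

definition k_projective ::
    "'u itself \<Rightarrow> ('a, 'r) ring_scheme \<Rightarrow> ('a, 'b, 'm) module_scheme
      \<Rightarrow> ('a, 'p, 'n) module_scheme \<Rightarrow> bool" where
  "k_projective (_ :: 'u itself) R M P \<longleftrightarrow>
     (\<forall>(N :: ('a, 'u) module) f g.
        left_semimodule R N \<and> f \<in> linear_maps R M N \<and> normal_map M N f \<and>
        f ` carrier M = carrier N \<and> g \<in> linear_maps R P N \<longrightarrow>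
        (\<exists>h\<in>linear_maps R P M. \<forall>p\<in>carrier P. f (h p) = g p))"

end

theory Submission
  imports Defs
begin

text \<open>
  The direct summands of \<open>S\<close> are governed by idempotents.  If \<open>S = N \<oplus> N'\<close>, the components \<open>e\<close> and
  \<open>f\<close> of \<open>\<one>\<close> satisfy \<open>e \<oplus> f = \<one>\<close> and \<open>e \<otimes> f = f \<otimes> e = \<zero>\<close>, and
  \<open>N = {x. x \<otimes> e = x} = {x. x \<otimes> f = \<zero>}\<close>; conversely every such pair gives a decomposition
  (\<open>direct_summand_iff_complementary\<close>).  The second description of \<open>N\<close> is what replaces
  subtraction: an equation modulo elements of \<open>N\<close> becomes an honest equation after multiplication
  by \<open>f\<close>.

  If every subtractive left ideal is a summand, then so is the kernel of each \<open>k\<close>-normal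
  surjection \<open>g\<close> from \<open>S\<close>, and \<open>g x \<mapsto> x \<otimes> f\<close> is a section of it; this makes the Hom sequence exact
  (\<open>e_projective_regular\<close>).  The lifting property is the surjectivity part of that exactness,
  applied to the sequence that starts with the kernel of a normal surjection.  The quotients
  \<open>S/I\<close> are particular semimodules, and the third term of an exact sequence is isomorphic to
  \<open>S/Ker g\<close>, so lifting this isomorphism splits the sequence.

  For the ascending chain condition, let \<open>I\<close> be the union of a chain of summands.  A section of
  \<open>S \<rightarrow> S/I\<close> sends the class of \<open>\<one>\<close> to some \<open>d\<close> with \<open>I \<otimes> d = {\<zero>}\<close>, and \<open>d\<close> is congruent to \<open>\<one>\<close>
  modulo finitely many elements of \<open>I\<close>, hence modulo one member of the chain.  That member is
  then all of \<open>I\<close> (\<open>acc_direct_summands_if_right_splits\<close>).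

  The last two implications rest on a modular law for summands, \<open>complementary_refine\<close>.  It
  allows ascending complements for a descending chain of summands, and it allows splitting off
  minimal summands from a given one; the latter process stops by the descending chain condition.

  The conditions quantify over semimodules whose carriers lie in a fixed type \<open>'u\<close>.  Kernels and
  quotients of \<open>S\<close> live in other types and are copied into \<open>'u\<close> by \<open>transport\<close>.
\<close>

section \<open>Semimodules and linear maps\<close>

lemma left_semimoduleI:
  assumes "semiring R"
    and "\<zero>\<^bsub>M\<^esub> \<in> carrier M"
    and "\<And>x y. \<lbrakk>x \<in> carrier M; y \<in> carrier M\<rbrakk> \<Longrightarrow> x \<oplus>\<^bsub>M\<^esub> y \<in> carrier M"
    and "\<And>x y z. \<lbrakk>x \<in> carrier M; y \<in> carrier M; z \<in> carrier M\<rbrakk>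
           \<Longrightarrow> (x \<oplus>\<^bsub>M\<^esub> y) \<oplus>\<^bsub>M\<^esub> z = x \<oplus>\<^bsub>M\<^esub> (y \<oplus>\<^bsub>M\<^esub> z)"
    and "\<And>x y. \<lbrakk>x \<in> carrier M; y \<in> carrier M\<rbrakk> \<Longrightarrow> x \<oplus>\<^bsub>M\<^esub> y = y \<oplus>\<^bsub>M\<^esub> x"
    and "\<And>x. x \<in> carrier M \<Longrightarrow> \<zero>\<^bsub>M\<^esub> \<oplus>\<^bsub>M\<^esub> x = x"
    and "\<And>a x. \<lbrakk>a \<in> carrier R; x \<in> carrier M\<rbrakk> \<Longrightarrow> a \<odot>\<^bsub>M\<^esub> x \<in> carrier M"
    and "\<And>a b x. \<lbrakk>a \<in> carrier R; b \<in> carrier R; x \<in> carrier M\<rbrakk>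
           \<Longrightarrow> (a \<oplus>\<^bsub>R\<^esub> b) \<odot>\<^bsub>M\<^esub> x = a \<odot>\<^bsub>M\<^esub> x \<oplus>\<^bsub>M\<^esub> b \<odot>\<^bsub>M\<^esub> x"
    and "\<And>a x y. \<lbrakk>a \<in> carrier R; x \<in> carrier M; y \<in> carrier M\<rbrakk>
           \<Longrightarrow> a \<odot>\<^bsub>M\<^esub> (x \<oplus>\<^bsub>M\<^esub> y) = a \<odot>\<^bsub>M\<^esub> x \<oplus>\<^bsub>M\<^esub> a \<odot>\<^bsub>M\<^esub> y"
    and "\<And>a b x. \<lbrakk>a \<in> carrier R; b \<in> carrier R; x \<in> carrier M\<rbrakk>
           \<Longrightarrow> (a \<otimes>\<^bsub>R\<^esub> b) \<odot>\<^bsub>M\<^esub> x = a \<odot>\<^bsub>M\<^esub> (b \<odot>\<^bsub>M\<^esub> x)"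
    and "\<And>x. x \<in> carrier M \<Longrightarrow> \<one>\<^bsub>R\<^esub> \<odot>\<^bsub>M\<^esub> x = x"
    and "\<And>a. a \<in> carrier R \<Longrightarrow> a \<odot>\<^bsub>M\<^esub> \<zero>\<^bsub>M\<^esub> = \<zero>\<^bsub>M\<^esub>"
    and "\<And>x. x \<in> carrier M \<Longrightarrow> \<zero>\<^bsub>R\<^esub> \<odot>\<^bsub>M\<^esub> x = \<zero>\<^bsub>M\<^esub>"
  shows "left_semimodule R M"
proof -
  have "abelian_monoid M"
    by (rule abelian_monoidI) (use assms in auto)
  then show ?thesis
    unfolding left_semimodule_def left_semimodule_axioms_def using assms by auto
qed

lemma regular_semimodule_simps [simp]:
  "carrier (regular_semimodule S) = carrier S"
  "\<zero>\<^bsub>regular_semimodule S\<^esub> = \<zero>\<^bsub>S\<^esub>"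
  "x \<oplus>\<^bsub>regular_semimodule S\<^esub> y = x \<oplus>\<^bsub>S\<^esub> y"
  "x \<odot>\<^bsub>regular_semimodule S\<^esub> y = x \<otimes>\<^bsub>S\<^esub> y"
  by (simp_all add: regular_semimodule_def)

lemma finsum_regular_semimodule [simp]: "finsum (regular_semimodule S) = finsum S"
  by (simp add: fun_eq_iff finsum_def finprod_def regular_semimodule_def)

lemma (in semiring) left_semimodule_regular: "left_semimodule R (regular_semimodule R)"
  by (rule left_semimoduleI)
    (auto simp: semiring_axioms a_ac l_distr r_distr m_assoc)

lemma left_semimodule_submodule:
  assumes "left_semimodule R M" and L: "subsemimodule R L M"
  shows "left_semimodule R (M\<lparr>carrier := L\<rparr>)"
proof -
  interpret M: left_semimodule R M by fact
  have [simp]: "x \<in> carrier M" if "x \<in> L" for x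
    using L that by (auto simp: subsemimodule_def)
  show ?thesis
    by (rule left_semimoduleI)
      (use L in \<open>auto simp: subsemimodule_def M.R.semiring_axioms M.M.a_ac
        M.smult_l_distr M.smult_r_distr M.smult_assoc M.smult_one M.smult_zero_left
        M.smult_zero_right\<close>)
qed

text \<open>All axioms are equations, so they pass to homomorphic images.  Quotients and
  isomorphic copies in another type are both obtained in this way.\<close>

lemma left_semimodule_image:
  assumes "left_semimodule R M" and surj: "p ` carrier M = carrier N"
    and zero: "p \<zero>\<^bsub>M\<^esub> = \<zero>\<^bsub>N\<^esub>"
    and add: "\<And>x y. \<lbrakk>x \<in> carrier M; y \<in> carrier M\<rbrakk> \<Longrightarrow> p (x \<oplus>\<^bsub>M\<^esub> y) = p x \<oplus>\<^bsub>N\<^esub> p y"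
    and smult: "\<And>a x. \<lbrakk>a \<in> carrier R; x \<in> carrier M\<rbrakk> \<Longrightarrow> p (a \<odot>\<^bsub>M\<^esub> x) = a \<odot>\<^bsub>N\<^esub> p x"
  shows "left_semimodule R N"
proof -
  interpret M: left_semimodule R M by fact
  have rep: "\<exists>x\<in>carrier M. y = p x" if "y \<in> carrier N" for y
    using surj that by auto
  have closed: "p x \<in> carrier N" if "x \<in> carrier M" for x
    using surj that by auto
  note pull = add [symmetric] smult [symmetric] zero [symmetric]
  show ?thesis
    by (rule left_semimoduleI, rule M.R.semiring_axioms)
      (auto dest!: rep simp: pull closed M.smult_closed M.M.a_ac M.smult_l_distr M.smult_r_distr
        M.smult_assoc M.smult_one M.smult_zero_left M.smult_zero_right)
qed

lemma
  assumes "f \<in> linear_maps R M N"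
  shows linear_maps_closed: "x \<in> carrier M \<Longrightarrow> f x \<in> carrier N"
    and linear_maps_add: "\<lbrakk>x \<in> carrier M; y \<in> carrier M\<rbrakk> \<Longrightarrow> f (x \<oplus>\<^bsub>M\<^esub> y) = f x \<oplus>\<^bsub>N\<^esub> f y"
    and linear_maps_smult: "\<lbrakk>a \<in> carrier R; x \<in> carrier M\<rbrakk> \<Longrightarrow> f (a \<odot>\<^bsub>M\<^esub> x) = a \<odot>\<^bsub>N\<^esub> f x"
  using assms by (auto simp: linear_maps_def)

lemma linear_mapsI:
  assumes "\<And>x. x \<in> carrier M \<Longrightarrow> f x \<in> carrier N"
    and "\<And>x y. \<lbrakk>x \<in> carrier M; y \<in> carrier M\<rbrakk> \<Longrightarrow> f (x \<oplus>\<^bsub>M\<^esub> y) = f x \<oplus>\<^bsub>N\<^esub> f y"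
    and "\<And>a x. \<lbrakk>a \<in> carrier R; x \<in> carrier M\<rbrakk> \<Longrightarrow> f (a \<odot>\<^bsub>M\<^esub> x) = a \<odot>\<^bsub>N\<^esub> f x"
  shows "f \<in> linear_maps R M N"
  using assms by (auto simp: linear_maps_def)

lemma linear_maps_zero:
  assumes "left_semimodule R M" "left_semimodule R N" and f: "f \<in> linear_maps R M N"
  shows "f \<zero>\<^bsub>M\<^esub> = \<zero>\<^bsub>N\<^esub>"
proof -
  interpret M: left_semimodule R M by fact
  interpret N: left_semimodule R N by fact
  have "f \<zero>\<^bsub>M\<^esub> = f (\<zero>\<^bsub>R\<^esub> \<odot>\<^bsub>M\<^esub> \<zero>\<^bsub>M\<^esub>)" by (simp add: M.smult_zero_left)
  also have "\<dots> = \<zero>\<^bsub>N\<^esub>"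
    using f by (simp add: linear_maps_smult linear_maps_closed N.smult_zero_left)
  finally show ?thesis .
qed

lemma linear_maps_comp:
  assumes "f \<in> linear_maps R L M" "g \<in> linear_maps R M N"
  shows "(\<lambda>x. g (f x)) \<in> linear_maps R L N"
  using assms by (auto simp: linear_maps_def Pi_def)

lemma linear_maps_factor:
  assumes M: "left_semimodule R M" and q: "q \<in> linear_maps R M Q" and surj: "q ` carrier M = carrier Q"
    and g: "g \<in> linear_maps R M N"
    and wd: "\<And>x y. \<lbrakk>x \<in> carrier M; y \<in> carrier M; q x = q y\<rbrakk> \<Longrightarrow> g x = g y"
  obtains h where "h \<in> linear_maps R Q N" "\<And>x. x \<in> carrier M \<Longrightarrow> h (q x) = g x"
proof -
  interpret M: left_semimodule R M by fact
  define h where "h = (\<lambda>y. g (inv_into (carrier M) q y))"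
  have h: "h (q x) = g x" if "x \<in> carrier M" for x
    unfolding h_def using that by (intro wd) (auto simp: inv_into_into f_inv_into_f)
  have rep: "\<exists>x\<in>carrier M. y = q x" if "y \<in> carrier Q" for y
    using surj that by auto
  have "h \<in> linear_maps R Q N"
  proof (rule linear_mapsI)
    fix y assume "y \<in> carrier Q"
    then show "h y \<in> carrier N"
      using rep h linear_maps_closed [OF g] by force
  next
    fix y y' assume "y \<in> carrier Q" "y' \<in> carrier Q"
    then obtain x x' where "x \<in> carrier M" "x' \<in> carrier M" "y = q x" "y' = q x'"
      using rep by meson
    then show "h (y \<oplus>\<^bsub>Q\<^esub> y') = h y \<oplus>\<^bsub>N\<^esub> h y'"
      by (simp flip: linear_maps_add [OF q] add: h linear_maps_add [OF g])
  next
    fix a y assume "a \<in> carrier R" "y \<in> carrier Q"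
    moreover from this obtain x where "x \<in> carrier M" "y = q x"
      using rep by meson
    ultimately show "h (a \<odot>\<^bsub>Q\<^esub> y) = a \<odot>\<^bsub>N\<^esub> h y"
      by (simp flip: linear_maps_smult [OF q] add: h linear_maps_smult [OF g] M.smult_closed)
  qed
  with h show ?thesis by (rule that[rotated])
qed

section \<open>Kernels, quotients and copies in another type\<close>

lemma mem_a_kernel: "x \<in> a_kernel M N g \<longleftrightarrow> x \<in> carrier M \<and> g x = \<zero>\<^bsub>N\<^esub>"
  by (simp add: a_kernel_def')

lemma
  assumes "left_semimodule R M" "left_semimodule R N" and g: "g \<in> linear_maps R M N"
  shows subsemimodule_kernel: "subsemimodule R (a_kernel M N g) M"
    and subtractive_kernel: "subtractive M (a_kernel M N g)"
proof -
  interpret M: left_semimodule R M by fact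
  interpret N: left_semimodule R N by fact
  note [simp] = mem_a_kernel linear_maps_zero [OF assms] linear_maps_add [OF g]
    linear_maps_smult [OF g] M.smult_closed N.smult_zero_right
  show "subsemimodule R (a_kernel M N g) M"
    by (auto simp: subsemimodule_def)
  have "x \<in> a_kernel M N g"
    if x: "x \<in> carrier M" and l: "l \<in> a_kernel M N g" "x \<oplus>\<^bsub>M\<^esub> l \<in> a_kernel M N g" for x l
    using that by (simp add: linear_maps_closed [OF g])
  moreover have "\<exists>l\<in>a_kernel M N g. x \<oplus>\<^bsub>M\<^esub> l \<in> a_kernel M N g" if "x \<in> a_kernel M N g" for x
    using that by (intro bexI [of _ "\<zero>\<^bsub>M\<^esub>"]) auto
  moreover have "a_kernel M N g \<subseteq> carrier M" by auto
  ultimately show "subtractive M (a_kernel M N g)"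
    unfolding subtractive_def subtractive_closure_def by (fastforce simp del: mem_a_kernel)
qed

definition transport :: "('b \<Rightarrow> 'c) \<Rightarrow> ('a, 'b, 'm) module_scheme \<Rightarrow> ('a, 'c) module" where
  "transport j M =
     \<lparr>carrier = j ` carrier M, mult = undefined, one = undefined, zero = j \<zero>\<^bsub>M\<^esub>,
      add = (\<lambda>x y. j (inv_into (carrier M) j x \<oplus>\<^bsub>M\<^esub> inv_into (carrier M) j y)),
      smult = (\<lambda>a x. j (a \<odot>\<^bsub>M\<^esub> inv_into (carrier M) j x))\<rparr>"

lemma transport_simps [simp]:
  "carrier (transport j M) = j ` carrier M"
  "\<zero>\<^bsub>transport j M\<^esub> = j \<zero>\<^bsub>M\<^esub>"
  by (simp_all add: transport_def)

lemma
  assumes "left_semimodule R M" and j: "inj_on j (carrier M)"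
  shows left_semimodule_transport: "left_semimodule R (transport j M)"
    and transport_linear: "j \<in> linear_maps R M (transport j M)"
    and transport_inv_linear: "inv_into (carrier M) j \<in> linear_maps R (transport j M) M"
proof -
  interpret M: left_semimodule R M by fact
  have add: "j (x \<oplus>\<^bsub>M\<^esub> y) = j x \<oplus>\<^bsub>transport j M\<^esub> j y"
    if "x \<in> carrier M" "y \<in> carrier M" for x y
    using that by (simp add: transport_def j)
  have smult: "j (a \<odot>\<^bsub>M\<^esub> x) = a \<odot>\<^bsub>transport j M\<^esub> j x"
    if "a \<in> carrier R" "x \<in> carrier M" for a x
    using that by (simp add: transport_def j)
  show "left_semimodule R (transport j M)"
    by (rule left_semimodule_image [OF assms(1)]) (auto simp: add smult)
  show "j \<in> linear_maps R M (transport j M)"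
    by (rule linear_mapsI) (auto simp: add smult)
  show "inv_into (carrier M) j \<in> linear_maps R (transport j M) M"
    by (rule linear_mapsI)
      (auto simp: j M.smult_closed simp flip: add smult)
qed

text \<open>The kernel is copied along \<open>j\<close> so that its carrier has the type over which the first
  module of an exact sequence ranges.\<close>

lemma short_exact_kernel:
  fixes M :: "('a, 'b, 'm) module_scheme" and j :: "'b \<Rightarrow> 'u"
  assumes "left_semimodule R M" "left_semimodule R N" and g: "g \<in> linear_maps R M N"
    and "g ` carrier M = carrier N" and "k_normal M N g"
    and j: "inj_on j (a_kernel M N g)"
  defines "K \<equiv> M\<lparr>carrier := a_kernel M N g\<rparr>"
  shows "short_exact R (transport j K) M N (inv_into (carrier K) j) g"
proof -
  have K: "left_semimodule R K"
    unfolding K_def by (intro left_semimodule_submodule subsemimodule_kernel assms)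
  have j': "inj_on j (carrier K)" using j by (simp add: K_def)
  have "inv_into (carrier K) j \<in> linear_maps R (transport j K) M"
    using transport_inv_linear [OF K j']
    by (auto simp: linear_maps_def K_def mem_a_kernel)
  then show ?thesis
    unfolding short_exact_def
    using assms left_semimodule_transport [OF K j'] j'
    by (auto simp: inj_on_inv_into image_image K_def intro: rev_image_eqI)
qed

lemma (in left_semimodule) quotient_facts:
  assumes L: "subsemimodule R L M"
  defines "Q \<equiv> quotient_semimodule M L" and "q \<equiv> (\<lambda>x. quotient_rel M L `` {x})"
  shows left_semimodule_quotient: "left_semimodule R Q"
    and quotient_proj_linear: "q \<in> linear_maps R M Q"
    and quotient_proj_surj: "q ` carrier M = carrier Q"
    and quotient_proj_eq_iff: "\<lbrakk>x \<in> carrier M; y \<in> carrier M\<rbrakk>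
      \<Longrightarrow> q x = q y \<longleftrightarrow> (\<exists>l\<in>L. \<exists>l'\<in>L. x \<oplus>\<^bsub>M\<^esub> l = y \<oplus>\<^bsub>M\<^esub> l')"
proof -
  have LM: "l \<in> carrier M" if "l \<in> L" for l
    using L that by (auto simp: subsemimodule_def)
  have L0: "\<zero>\<^bsub>M\<^esub> \<in> L" and Ladd: "\<And>x y. \<lbrakk>x \<in> L; y \<in> L\<rbrakk> \<Longrightarrow> x \<oplus>\<^bsub>M\<^esub> y \<in> L"
    and Lsm: "\<And>a x. \<lbrakk>a \<in> carrier R; x \<in> L\<rbrakk> \<Longrightarrow> a \<odot>\<^bsub>M\<^esub> x \<in> L"
    using L by (auto simp: subsemimodule_def)
  have rel_iff: "(x, y) \<in> quotient_rel M L \<longleftrightarrow>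
      x \<in> carrier M \<and> y \<in> carrier M \<and> (\<exists>l\<in>L. \<exists>l'\<in>L. x \<oplus>\<^bsub>M\<^esub> l = y \<oplus>\<^bsub>M\<^esub> l')" for x y
    by (auto simp: quotient_rel_def)
  have add_rel: "(x \<oplus>\<^bsub>M\<^esub> y, x' \<oplus>\<^bsub>M\<^esub> y') \<in> quotient_rel M L"
    if "(x, x') \<in> quotient_rel M L" "(y, y') \<in> quotient_rel M L" for x x' y y'
  proof -
    from that obtain l l' k k' where *: "l \<in> L" "l' \<in> L" "k \<in> L" "k' \<in> L"
      "x \<oplus>\<^bsub>M\<^esub> l = x' \<oplus>\<^bsub>M\<^esub> l'" "y \<oplus>\<^bsub>M\<^esub> k = y' \<oplus>\<^bsub>M\<^esub> k'"
      and c: "x \<in> carrier M" "y \<in> carrier M" "x' \<in> carrier M" "y' \<in> carrier M"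
      unfolding rel_iff by blast
    have "(x \<oplus>\<^bsub>M\<^esub> y) \<oplus>\<^bsub>M\<^esub> (l \<oplus>\<^bsub>M\<^esub> k) = (x \<oplus>\<^bsub>M\<^esub> l) \<oplus>\<^bsub>M\<^esub> (y \<oplus>\<^bsub>M\<^esub> k)"
      using *(1-4) c LM by (simp add: M.a_ac)
    also have "\<dots> = (x' \<oplus>\<^bsub>M\<^esub> y') \<oplus>\<^bsub>M\<^esub> (l' \<oplus>\<^bsub>M\<^esub> k')"
      unfolding *(5,6) using *(1-4) c LM by (simp add: M.a_ac)
    finally show ?thesis
      unfolding rel_iff using * c Ladd by auto
  qed
  have refl: "(x, x) \<in> quotient_rel M L" if "x \<in> carrier M" for x
    using that L0 unfolding rel_iff by auto
  have eqv: "equiv (carrier M) (quotient_rel M L)"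
  proof (rule equivI)
    show "quotient_rel M L \<subseteq> carrier M \<times> carrier M" by (auto simp: rel_iff)
    show "refl_on (carrier M) (quotient_rel M L)" by (auto simp: refl_on_def refl)
    show "sym (quotient_rel M L)" by (rule symI) (metis rel_iff)
    show "trans (quotient_rel M L)"
    proof (rule transI)
      fix x y z assume "(x, y) \<in> quotient_rel M L" "(y, z) \<in> quotient_rel M L"
      then obtain l l' k k' where *: "l \<in> L" "l' \<in> L" "k \<in> L" "k' \<in> L"
        "x \<oplus>\<^bsub>M\<^esub> l = y \<oplus>\<^bsub>M\<^esub> l'" "y \<oplus>\<^bsub>M\<^esub> k = z \<oplus>\<^bsub>M\<^esub> k'"
        and c: "x \<in> carrier M" "y \<in> carrier M" "z \<in> carrier M"
        unfolding rel_iff by blast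
      have "x \<oplus>\<^bsub>M\<^esub> (l \<oplus>\<^bsub>M\<^esub> k) = (x \<oplus>\<^bsub>M\<^esub> l) \<oplus>\<^bsub>M\<^esub> k"
        using *(1-4) c LM by (simp add: M.a_ac)
      also have "\<dots> = (y \<oplus>\<^bsub>M\<^esub> k) \<oplus>\<^bsub>M\<^esub> l'"
        unfolding *(5) using *(1-4) c LM by (simp add: M.a_ac)
      also have "\<dots> = z \<oplus>\<^bsub>M\<^esub> (k' \<oplus>\<^bsub>M\<^esub> l')"
        unfolding *(6) using *(1-4) c LM by (simp add: M.a_ac)
      finally show "(x, z) \<in> quotient_rel M L"
        unfolding rel_iff using * c Ladd by blast
    qed
  qed
  have add: "q (x \<oplus>\<^bsub>M\<^esub> y) = q x \<oplus>\<^bsub>Q\<^esub> q y" if "x \<in> carrier M" "y \<in> carrier M" for x y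
  proof -
    have "congruent2 (quotient_rel M L) (quotient_rel M L)
        (\<lambda>x y. quotient_rel M L `` {x \<oplus>\<^bsub>M\<^esub> y})"
      by (rule congruent2I') (rule equiv_class_eq [OF eqv add_rel])
    from UN_equiv_class2 [OF eqv eqv this that] show ?thesis
      by (simp add: Q_def q_def quotient_semimodule_def)
  qed
  have smult: "q (a \<odot>\<^bsub>M\<^esub> x) = a \<odot>\<^bsub>Q\<^esub> q x" if "a \<in> carrier R" "x \<in> carrier M" for a x
  proof -
    have "congruent (quotient_rel M L) (\<lambda>x. quotient_rel M L `` {a \<odot>\<^bsub>M\<^esub> x})"
    proof (rule congruentI, rule equiv_class_eq [OF eqv])
      fix y z assume "(y, z) \<in> quotient_rel M L"
      then obtain l l' where *: "l \<in> L" "l' \<in> L" "y \<oplus>\<^bsub>M\<^esub> l = z \<oplus>\<^bsub>M\<^esub> l'"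
        and c: "y \<in> carrier M" "z \<in> carrier M"
        unfolding rel_iff by blast
      have "a \<odot>\<^bsub>M\<^esub> y \<oplus>\<^bsub>M\<^esub> a \<odot>\<^bsub>M\<^esub> l = a \<odot>\<^bsub>M\<^esub> z \<oplus>\<^bsub>M\<^esub> a \<odot>\<^bsub>M\<^esub> l'"
        using * c that LM by (metis smult_r_distr)
      then show "(a \<odot>\<^bsub>M\<^esub> y, a \<odot>\<^bsub>M\<^esub> z) \<in> quotient_rel M L"
        unfolding rel_iff using * c that Lsm by (auto simp: smult_closed)
    qed
    from UN_equiv_class [OF eqv this that(2)] show ?thesis
      by (simp add: Q_def q_def quotient_semimodule_def)
  qed
  show surj: "q ` carrier M = carrier Q"
    by (auto simp: Q_def q_def quotient_semimodule_def quotient_def)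
  have zero: "q \<zero>\<^bsub>M\<^esub> = \<zero>\<^bsub>Q\<^esub>"
    by (simp add: Q_def q_def quotient_semimodule_def)
  show "left_semimodule R Q"
    by (rule left_semimodule_image [OF left_semimodule_axioms surj zero add smult])
  show "q \<in> linear_maps R M Q"
    by (rule linear_mapsI) (use surj in \<open>auto simp: add smult\<close>)
  show "q x = q y \<longleftrightarrow> (\<exists>l\<in>L. \<exists>l'\<in>L. x \<oplus>\<^bsub>M\<^esub> l = y \<oplus>\<^bsub>M\<^esub> l')"
    if "x \<in> carrier M" "y \<in> carrier M"
    using eq_equiv_class_iff [OF eqv that] that by (simp add: q_def rel_iff)
qed

lemma kernel_quotient_proj:
  assumes "left_semimodule R M" and L: "subsemimodule R L M" and sub: "subtractive M L"
  shows "a_kernel M (quotient_semimodule M L) (\<lambda>x. quotient_rel M L `` {x}) = L"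
proof -
  interpret M: left_semimodule R M by fact
  have LM: "L \<subseteq> carrier M" and L0: "\<zero>\<^bsub>M\<^esub> \<in> L" 
    using L by (auto simp: subsemimodule_def)
  have "x \<in> a_kernel M (quotient_semimodule M L) (\<lambda>x. quotient_rel M L `` {x}) \<longleftrightarrow>
      x \<in> subtractive_closure M L" for x
    using M.quotient_proj_eq_iff [OF L, of x "\<zero>\<^bsub>M\<^esub>"] LM
    by (auto simp: mem_a_kernel quotient_semimodule_def subtractive_closure_def subset_eq)
  with sub show ?thesis unfolding subtractive_def by blast
qed

section \<open>Direct summands of a semiring and idempotents\<close>

lemma is_direct_sum_finite:
  fixes M :: "('a, 'b, 'm) module_scheme"
  assumes "abelian_monoid M" and "finite I"
  shows "is_direct_sum R M I L \<longleftrightarrow> (\<forall>i\<in>I. subsemimodule R (L i) M) \<and>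
    (\<forall>m\<in>carrier M. \<exists>!x. x \<in> (\<Pi>\<^sub>E i\<in>I. L i) \<and> m = finsum M x I)"
proof -
  interpret M: abelian_monoid M by fact
  have "finsum M x {i \<in> I. x i \<noteq> \<zero>\<^bsub>M\<^esub>} = finsum M x I"
    if "\<forall>i\<in>I. subsemimodule R (L i) M" "x \<in> (\<Pi>\<^sub>E i\<in>I. L i)" for x
  proof (rule M.add.finprod_mono_neutral_cong_left)
    show "x \<in> I \<rightarrow> carrier M"
      using that by (fastforce simp: PiE_iff subsemimodule_def)
  qed (use \<open>finite I\<close> in auto)
  then show ?thesis
    unfolding is_direct_sum_def using \<open>finite I\<close> by (auto cong: conj_cong)
qed

lemma direct_summand_iff:
  fixes M :: "('a, 'b, 'm) module_scheme"
  assumes "abelian_monoid M"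
  shows "direct_summand R N M \<longleftrightarrow> (\<exists>N'. subsemimodule R N M \<and> subsemimodule R N' M \<and>
    (\<forall>m\<in>carrier M. \<exists>n\<in>N. \<exists>n'\<in>N'. m = n \<oplus>\<^bsub>M\<^esub> n') \<and>
    (\<forall>n\<in>N. \<forall>n'\<in>N'. \<forall>k\<in>N. \<forall>k'\<in>N'. n \<oplus>\<^bsub>M\<^esub> n' = k \<oplus>\<^bsub>M\<^esub> k' \<longrightarrow> n = k \<and> n' = k'))"
proof -
  interpret M: abelian_monoid M by fact
  have *: "(\<forall>m\<in>carrier M. \<exists>!x. x \<in> (\<Pi>\<^sub>E b\<in>UNIV. if b then N else N') \<and> m = finsum M x UNIV) \<longleftrightarrow>
      (\<forall>m\<in>carrier M. \<exists>n\<in>N. \<exists>n'\<in>N'. m = n \<oplus>\<^bsub>M\<^esub> n') \<and>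
      (\<forall>n\<in>N. \<forall>n'\<in>N'. \<forall>k\<in>N. \<forall>k'\<in>N'. n \<oplus>\<^bsub>M\<^esub> n' = k \<oplus>\<^bsub>M\<^esub> k' \<longrightarrow> n = k \<and> n' = k')"
    (is "?lhs \<longleftrightarrow> ?rhs")
    if "subsemimodule R N M" "subsemimodule R N' M" for N'
  proof -
    have NM: "N \<subseteq> carrier M" "N' \<subseteq> carrier M"
      using that by (auto simp: subsemimodule_def)
    have mem: "x \<in> (\<Pi>\<^sub>E b\<in>UNIV. if b then N else N') \<longleftrightarrow> x True \<in> N \<and> x False \<in> N'" for x
      by (auto simp: PiE_iff split: if_splits)
    have sum: "finsum M x UNIV = x True \<oplus>\<^bsub>M\<^esub> x False" if "x True \<in> N" "x False \<in> N'" for x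
      using that NM by (simp add: UNIV_bool M.a_comm subset_eq)
    show ?thesis
    proof
      assume l: ?lhs
      show ?rhs
      proof (intro conjI ballI impI)
        fix m assume "m \<in> carrier M"
        then obtain x where "x True \<in> N" "x False \<in> N'" "m = finsum M x UNIV"
          using l unfolding mem by blast
        then show "\<exists>n\<in>N. \<exists>n'\<in>N'. m = n \<oplus>\<^bsub>M\<^esub> n'"
          using sum by blast
      next
        fix n n' k k' assume *: "n \<in> N" "n' \<in> N'" "k \<in> N" "k' \<in> N'" "n \<oplus>\<^bsub>M\<^esub> n' = k \<oplus>\<^bsub>M\<^esub> k'"
        let ?x = "\<lambda>b. if b then n else n'" and ?y = "\<lambda>b. if b then k else k'"
        have "n \<oplus>\<^bsub>M\<^esub> n' = finsum M ?x UNIV" "n \<oplus>\<^bsub>M\<^esub> n' = finsum M ?y UNIV"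
          using * by (simp_all add: sum)
        moreover have "n \<oplus>\<^bsub>M\<^esub> n' \<in> carrier M" using * NM by auto
        ultimately have "?x = ?y"
          using l * unfolding mem by (smt (verit, best))
        then show "n = k" "n' = k'"
          by (metis (full_types))+
      qed
    next
      assume r: ?rhs
      show ?lhs
      proof
        fix m assume "m \<in> carrier M"
        then obtain n n' where *: "n \<in> N" "n' \<in> N'" "m = n \<oplus>\<^bsub>M\<^esub> n'"
          using r by blast
        show "\<exists>!x. x \<in> (\<Pi>\<^sub>E b\<in>UNIV. if b then N else N') \<and> m = finsum M x UNIV"
        proof (rule ex1I [of _ "\<lambda>b. if b then n else n'"])
          fix x assume "x \<in> (\<Pi>\<^sub>E b\<in>UNIV. if b then N else N') \<and> m = finsum M x UNIV"
          then have x: "x True \<in> N" "x False \<in> N'" "m = x True \<oplus>\<^bsub>M\<^esub> x False"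
            by (auto simp: mem sum)
          then have "x True = n \<and> x False = n'"
            using r * by auto
          then show "x = (\<lambda>b. if b then n else n')"
            by auto
        qed (use * in \<open>auto simp: mem sum\<close>)
      qed
    qed
  qed
  show ?thesis
    unfolding direct_summand_def is_direct_sum_finite [OF assms finite_UNIV]
    using * by (simp add: all_bool_eq cong: conj_cong) 
qed

text \<open>For an idempotent \<open>e\<close> this is the left ideal generated by \<open>e\<close>; membership as a
  fixed-point equation spares the choice of a cofactor.\<close>

definition fixed_ideal :: "('a, 'r) ring_scheme \<Rightarrow> 'a \<Rightarrow> 'a set" where
  "fixed_ideal R e = {x \<in> carrier R. x \<otimes>\<^bsub>R\<^esub> e = x}"

text \<open>In a ring \<open>f = \<one> \<ominus> e\<close>; without subtraction the complement is extra data.\<close>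

definition complementary :: "('a, 'r) ring_scheme \<Rightarrow> 'a \<Rightarrow> 'a \<Rightarrow> bool" where
  "complementary R e f \<longleftrightarrow> e \<in> carrier R \<and> f \<in> carrier R \<and> e \<oplus>\<^bsub>R\<^esub> f = \<one>\<^bsub>R\<^esub> \<and>
     e \<otimes>\<^bsub>R\<^esub> f = \<zero>\<^bsub>R\<^esub> \<and> f \<otimes>\<^bsub>R\<^esub> e = \<zero>\<^bsub>R\<^esub>"

context semiring
begin

lemma complementary_sym: "complementary R e f \<Longrightarrow> complementary R f e"
  by (auto simp: complementary_def a_comm)

lemma
  assumes "complementary R e f"
  shows complementary_closed: "e \<in> carrier R" "f \<in> carrier R"
    and complementary_mult: "e \<otimes> f = \<zero>" "f \<otimes> e = \<zero>"
    and complementary_sum: "e \<oplus> f = \<one>"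
  using assms by (auto simp: complementary_def)

lemma complementary_split:
  assumes "complementary R e f" "x \<in> carrier R"
  shows "x \<otimes> e \<oplus> x \<otimes> f = x" "e \<otimes> x \<oplus> f \<otimes> x = x"
  using assms by (auto simp: complementary_def simp flip: l_distr r_distr)

lemma complementary_idem:
  assumes "complementary R e f"
  shows "e \<otimes> e = e" "f \<otimes> f = f"
  using complementary_split(1) [OF assms, of e] complementary_split(1) [OF assms, of f] assms
  by (auto simp: complementary_def)

lemma fixed_ideal_iff:
  assumes "complementary R e f"
  shows "x \<in> fixed_ideal R e \<longleftrightarrow> x \<in> carrier R \<and> x \<otimes> f = \<zero>"
proof -
  have [simp]: "e \<in> carrier R" "f \<in> carrier R" "e \<otimes> f = \<zero>"
    using assms by (auto simp: complementary_def)
  show ?thesis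
  proof
    assume "x \<in> fixed_ideal R e"
    then have x: "x \<in> carrier R" "x \<otimes> e = x" by (auto simp: fixed_ideal_def)
    then show "x \<in> carrier R \<and> x \<otimes> f = \<zero>" using m_assoc [of x e f] by simp
  next
    assume "x \<in> carrier R \<and> x \<otimes> f = \<zero>"
    then show "x \<in> fixed_ideal R e"
      using complementary_split(1) [OF assms, of x] by (auto simp: fixed_ideal_def)
  qed
qed

lemma complementary_mem: "complementary R e f \<Longrightarrow> e \<in> fixed_ideal R e"
  by (simp add: fixed_ideal_def complementary_idem complementary_closed)

lemma fixed_ideal_subset_carrier: "fixed_ideal R e \<subseteq> carrier R"
  by (auto simp: fixed_ideal_def)

lemma fixed_ideal_one: "fixed_ideal R \<one> = carrier R"
  by (auto simp: fixed_ideal_def)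

lemma fixed_ideal_mono:
  assumes "x \<otimes> y = x" "x \<in> carrier R" "y \<in> carrier R"
  shows "fixed_ideal R x \<subseteq> fixed_ideal R y"
  using assms by (auto simp: fixed_ideal_def) (metis m_assoc)

lemma subsemimodule_fixed_ideal:
  assumes "e \<in> carrier R"
  shows "subsemimodule R (fixed_ideal R e) (regular_semimodule R)"
  using assms by (auto simp: subsemimodule_def fixed_ideal_def l_distr m_assoc)

lemma abelian_monoid_corner:
  assumes "e \<in> carrier R"
  shows "abelian_monoid ((regular_semimodule R)\<lparr>carrier := fixed_ideal R e\<rparr>)"
  using left_semimodule_submodule [OF left_semimodule_regular subsemimodule_fixed_ideal [OF assms]]
  by (simp add: left_semimodule_def)

lemma is_direct_sum_fixed_ideals:
  assumes fin: "finite I" and e: "\<And>i. i \<in> I \<Longrightarrow> e i \<in> carrier R"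
    and orth: "\<And>i j. \<lbrakk>i \<in> I; j \<in> I; i \<noteq> j\<rbrakk> \<Longrightarrow> e i \<otimes> e j = \<zero>"
    and idem: "\<And>i. i \<in> I \<Longrightarrow> e i \<otimes> e i = e i"
    and sum: "finsum R e I = \<one>"
  shows "is_direct_sum R (regular_semimodule R) I (\<lambda>i. fixed_ideal R (e i))"
proof -
  let ?L = "\<lambda>i. fixed_ideal R (e i)"
  have am: "abelian_monoid (regular_semimodule R)"
    using left_semimodule_regular by (simp add: left_semimodule_def)
  have "\<exists>!x. x \<in> (\<Pi>\<^sub>E i\<in>I. ?L i) \<and> m = finsum R x I" if m: "m \<in> carrier R" for m
  proof (rule ex1I [of _ "\<lambda>i\<in>I. m \<otimes> e i"])
    have "m = m \<otimes> finsum R e I" using m sum by simp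
    also have "\<dots> = (\<Oplus>i\<in>I. m \<otimes> e i)" using e m fin by (intro finsum_rdistr) auto
    also have "\<dots> = finsum R (\<lambda>i\<in>I. m \<otimes> e i) I" using e m by (intro finsum_cong') auto
    finally have "m = finsum R (\<lambda>i\<in>I. m \<otimes> e i) I" .
    moreover have "(\<lambda>i\<in>I. m \<otimes> e i) \<in> (\<Pi>\<^sub>E i\<in>I. ?L i)"
      using e m idem by (auto simp: fixed_ideal_def m_assoc)
    ultimately show "(\<lambda>i\<in>I. m \<otimes> e i) \<in> (\<Pi>\<^sub>E i\<in>I. ?L i) \<and> m = finsum R (\<lambda>i\<in>I. m \<otimes> e i) I"
      by blast
  next
    fix x assume "x \<in> (\<Pi>\<^sub>E i\<in>I. ?L i) \<and> m = finsum R x I"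
    then have x: "x \<in> extensional I" "\<And>i. i \<in> I \<Longrightarrow> x i \<in> carrier R"
      "\<And>i. i \<in> I \<Longrightarrow> x i \<otimes> e i = x i" and mx: "m = finsum R x I"
      by (auto simp: PiE_iff fixed_ideal_def)
    have "m \<otimes> e j = x j" if j: "j \<in> I" for j
    proof -
      have "m \<otimes> e j = (\<Oplus>i\<in>I. x i \<otimes> e j)"
        unfolding mx using e x j fin by (intro finsum_ldistr) auto
      also have "\<dots> = (\<Oplus>i\<in>I. if j = i then x i else \<zero>)"
      proof (rule finsum_cong')
        fix i assume i: "i \<in> I"
        have "x i \<otimes> e j = x i \<otimes> (e i \<otimes> e j)" using i j x e by (simp flip: m_assoc)
        then show "x i \<otimes> e j = (if j = i then x i else \<zero>)"
          using i j x orth by auto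
      qed (use x in auto)
      also have "\<dots> = x j" by (rule finsum_singleton) (use x j fin in auto)
      finally show ?thesis .
    qed
    then show "x = (\<lambda>i\<in>I. m \<otimes> e i)"
      using x(1) by (auto simp: extensional_def)
  qed
  with subsemimodule_fixed_ideal [OF e] show ?thesis
    by (simp add: is_direct_sum_finite [OF am fin])
qed

text \<open>Let \<open>a\<close> and \<open>b\<close> be the components of \<open>e\<close>.  Every \<open>x\<close> in \<open>N\<close> has the two decompositions
  \<open>x \<oplus> \<zero>\<close> and \<open>x \<otimes> a \<oplus> x \<otimes> b\<close>; by uniqueness \<open>x \<otimes> a = x\<close> and \<open>x \<otimes> b = \<zero>\<close>, and \<open>x = a\<close> is a
  special case.  The case \<open>e = \<one>\<close> describes the summands of the semiring itself.\<close>

lemma direct_summand_corner: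
  assumes e: "e \<in> carrier R" "e \<otimes> e = e"
    and N: "direct_summand R N ((regular_semimodule R)\<lparr>carrier := fixed_ideal R e\<rparr>)"
  obtains a b where "a \<in> carrier R" "b \<in> carrier R" "a \<oplus> b = e" "a \<otimes> b = \<zero>" "b \<otimes> a = \<zero>"
    "a \<otimes> e = a" "N = fixed_ideal R a"
proof -
  let ?M = "(regular_semimodule R)\<lparr>carrier := fixed_ideal R e\<rparr>"
  from N obtain N' where N: "subsemimodule R N ?M" and N': "subsemimodule R N' ?M"
    and dec: "\<And>m. m \<in> fixed_ideal R e \<Longrightarrow> \<exists>n\<in>N. \<exists>n'\<in>N'. m = n \<oplus> n'"
    and uniq: "\<And>n n' k k'. \<lbrakk>n \<in> N; n' \<in> N'; k \<in> N; k' \<in> N'; n \<oplus> n' = k \<oplus> k'\<rbrakk> \<Longrightarrow> n = k \<and> n' = k'"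
    unfolding direct_summand_iff [OF abelian_monoid_corner [OF e(1)]] by auto
  have cl: "x \<in> carrier R" "x \<otimes> e = x" if "x \<in> N \<or> x \<in> N'" for x
    using that N N' by (auto simp: subsemimodule_def fixed_ideal_def)
  have sm: "y \<otimes> x \<in> N" if "x \<in> N" "y \<in> carrier R" for x y
    using that N by (auto simp: subsemimodule_def)
  have sm': "y \<otimes> x \<in> N'" if "x \<in> N'" "y \<in> carrier R" for x y
    using that N' by (auto simp: subsemimodule_def)
  have z: "\<zero> \<in> N" "\<zero> \<in> N'" using N N' by (auto simp: subsemimodule_def)
  have "e \<in> fixed_ideal R e" using e by (simp add: fixed_ideal_def)
  then obtain a b where ab: "a \<in> N" "b \<in> N'" "e = a \<oplus> b" using dec by blast
  have abc: "a \<in> carrier R" "b \<in> carrier R" using ab cl by auto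
  have N_iff: "x \<otimes> a = x \<and> x \<otimes> b = \<zero>" if "x \<in> N" for x
  proof -
    have "x \<otimes> a \<oplus> x \<otimes> b = x \<otimes> e" unfolding ab(3) using that abc cl by (simp add: r_distr)
    also have "\<dots> = x \<oplus> \<zero>" using that cl by simp
    finally show ?thesis using that ab sm sm' cl z by (intro uniq) auto
  qed
  have N'_iff: "x \<otimes> a = \<zero> \<and> x \<otimes> b = x" if "x \<in> N'" for x
  proof -
    have "x \<otimes> a \<oplus> x \<otimes> b = x \<otimes> e" unfolding ab(3) using that abc cl by (simp add: r_distr)
    also have "\<dots> = \<zero> \<oplus> x" using that cl by simp
    finally show ?thesis using that ab sm sm' cl z by (intro uniq) auto
  qed
  have "N = fixed_ideal R a"
  proof (intro subset_antisym subsetI)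
    fix x assume "x \<in> N" then show "x \<in> fixed_ideal R a"
      using N_iff cl by (simp add: fixed_ideal_def)
  next
    fix x assume "x \<in> fixed_ideal R a" then show "x \<in> N"
      unfolding fixed_ideal_def using sm [OF ab(1), of x] by auto
  qed
  moreover have "a \<otimes> e = a" using cl ab by blast
  ultimately show ?thesis using that [of a b] ab abc N_iff N'_iff by blast
qed

lemma direct_summand_iff_complementary:
  "direct_summand R N (regular_semimodule R) \<longleftrightarrow> (\<exists>e f. complementary R e f \<and> N = fixed_ideal R e)"
proof
  assume "direct_summand R N (regular_semimodule R)"
  then have "direct_summand R N ((regular_semimodule R)\<lparr>carrier := fixed_ideal R \<one>\<rparr>)"
    by (simp add: fixed_ideal_one regular_semimodule_def)
  then show "\<exists>e f. complementary R e f \<and> N = fixed_ideal R e"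
    by (rule direct_summand_corner [rotated 2]) (auto simp: complementary_def)
next
  assume "\<exists>e f. complementary R e f \<and> N = fixed_ideal R e"
  then obtain e f where ef: "complementary R e f" and N: "N = fixed_ideal R e" by blast
  have "finsum R (\<lambda>b. if b then e else f) UNIV = \<one>"
    using ef by (simp add: UNIV_bool complementary_closed complementary_sum a_comm)
  then have "is_direct_sum R (regular_semimodule R) UNIV (\<lambda>b. fixed_ideal R (if b then e else f))"
    by (intro is_direct_sum_fixed_ideals)
      (use ef in \<open>auto simp: complementary_def complementary_idem\<close>)
  then show "direct_summand R N (regular_semimodule R)"
    unfolding direct_summand_def N by (auto simp: if_distrib)
qed

text \<open>This makes a summand of a summand a summand: the two complements \<open>b\<close> and \<open>f\<close> are added
  up.\<close>

lemma complementary_corner: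
  assumes ef: "complementary R e f" and ab: "a \<in> carrier R" "b \<in> carrier R" "a \<oplus> b = e"
    "a \<otimes> b = \<zero>" "b \<otimes> a = \<zero>" "a \<otimes> e = a"
  shows "complementary R a (b \<oplus> f)"
proof -
  note [simp] = complementary_closed [OF ef] complementary_mult [OF ef] ab
  have aa: "a \<otimes> a = a" using ab r_distr [of a b a] by simp
  have "e \<otimes> a = a" using aa l_distr [of a b a] by simp
  then have "f \<otimes> a = \<zero>" using m_assoc [of f e a] by simp
  moreover have "a \<otimes> f = \<zero>" using m_assoc [of a e f] by simp
  moreover have "a \<oplus> (b \<oplus> f) = \<one>" using complementary_sum [OF ef] by (simp flip: a_assoc)
  ultimately show ?thesis by (simp add: complementary_def r_distr l_distr)
qed

text \<open>This is the modular law: a summand that lies in another one is a summand of the latter.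
  Inclusion only says \<open>e' \<otimes> e = e'\<close>, while \<open>e \<otimes> e'\<close> may differ from \<open>e'\<close>.  It generates the same
  left ideal, however, and it is an orthogonal component of \<open>e\<close>.  For \<open>e \<otimes> f' \<otimes> f = \<zero>\<close>, which
  in a ring follows by subtraction, multiply \<open>e = e \<otimes> e' \<oplus> e \<otimes> f'\<close> by \<open>f\<close>; the first term
  vanishes.\<close>

lemma complementary_refine:
  assumes ef: "complementary R e f" and ef': "complementary R e' f'"
    and sub: "fixed_ideal R e' \<subseteq> fixed_ideal R e"
  defines "a \<equiv> e \<otimes> e'" and "b \<equiv> e \<otimes> f'"
  shows "a \<in> carrier R" "b \<in> carrier R" "a \<oplus> b = e" "a \<otimes> b = \<zero>" "b \<otimes> a = \<zero>"
    and "a \<otimes> e = a" "b \<otimes> e = b"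
    and "fixed_ideal R a = fixed_ideal R e'"
proof -
  note [simp] = complementary_closed [OF ef] complementary_mult [OF ef] complementary_idem [OF ef]
    complementary_closed [OF ef'] complementary_mult [OF ef'] complementary_idem [OF ef']
  have e': "e' \<in> fixed_ideal R e" using sub complementary_mem [OF ef'] by auto
  then have [simp]: "e' \<otimes> e = e'" by (simp add: fixed_ideal_def)
  have [simp]: "e' \<otimes> f = \<zero>" using e' by (simp add: fixed_ideal_iff [OF ef])
  show [simp]: "a \<in> carrier R" "b \<in> carrier R" by (simp_all add: a_def b_def)
  show sum: "a \<oplus> b = e"
    unfolding a_def b_def using complementary_split(1) [OF ef', of e] by simp
  show "a \<otimes> e = a" by (simp add: a_def m_assoc)
  have "a \<otimes> f = \<zero>" by (simp add: a_def m_assoc)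
  then have "b \<otimes> f = a \<otimes> f \<oplus> b \<otimes> f" by simp
  also have "\<dots> = \<zero>" by (simp add: sum flip: l_distr)
  finally have "b \<in> fixed_ideal R e" by (simp add: fixed_ideal_iff [OF ef])
  then show be: "b \<otimes> e = b" by (simp add: fixed_ideal_def)
  have "a \<otimes> b = e \<otimes> (e' \<otimes> e) \<otimes> f'"
    by (simp only: a_def b_def m_assoc m_closed complementary_closed [OF ef]
        complementary_closed [OF ef'])
  then show "a \<otimes> b = \<zero>" by (simp add: m_assoc)
  have "b \<otimes> a = (b \<otimes> e) \<otimes> e'"
    by (simp only: a_def m_assoc m_closed \<open>b \<in> carrier R\<close> complementary_closed [OF ef]
        complementary_closed [OF ef'])
  then show "b \<otimes> a = \<zero>" unfolding be by (simp add: b_def m_assoc)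
  have "fixed_ideal R a \<subseteq> fixed_ideal R e'"
    by (rule fixed_ideal_mono) (simp_all add: a_def m_assoc)
  moreover have "e' \<otimes> a = e'" by (simp add: a_def flip: m_assoc)
  then have "fixed_ideal R e' \<subseteq> fixed_ideal R a"
    by (intro fixed_ideal_mono) simp_all
  ultimately show "fixed_ideal R a = fixed_ideal R e'" ..
qed

end

section \<open>Hom semimodules\<close>

lemma Hom_semimodule_simps [simp]:
  "carrier (Hom_semimodule R P M) = linear_maps R P M \<inter> extensional (carrier P)"
  "\<zero>\<^bsub>Hom_semimodule R P M\<^esub> = (\<lambda>p\<in>carrier P. \<zero>\<^bsub>M\<^esub>)"
  "h \<oplus>\<^bsub>Hom_semimodule R P M\<^esub> h' = (\<lambda>p\<in>carrier P. h p \<oplus>\<^bsub>M\<^esub> h' p)"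
  "n \<odot>\<^bsub>Hom_semimodule R P M\<^esub> h = (\<lambda>p\<in>carrier P. [n] \<cdot>\<^bsub>M\<^esub> h p)"
  by (simp_all add: Hom_semimodule_def)

lemma nat_semiring_simps [simp]:
  "carrier nat_semiring = UNIV" "\<zero>\<^bsub>nat_semiring\<^esub> = 0" "\<one>\<^bsub>nat_semiring\<^esub> = 1"
  "a \<oplus>\<^bsub>nat_semiring\<^esub> b = a + b" "a \<otimes>\<^bsub>nat_semiring\<^esub> b = a * b"
  by (simp_all add: nat_semiring_def)

lemma semiring_nat_semiring: "semiring nat_semiring"
proof -
  have "abelian_monoid nat_semiring" by (rule abelian_monoidI) auto
  moreover have "Group.monoid nat_semiring" by (rule monoidI) auto
  ultimately show ?thesis
    by (auto simp: semiring_def semiring_axioms_def algebra_simps)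
qed

lemma add_pow_additive:
  fixes n :: nat
  assumes "abelian_monoid M" "abelian_monoid N" and x: "x \<in> carrier M"
    and f: "\<And>x. x \<in> carrier M \<Longrightarrow> f x \<in> carrier N" "f \<zero>\<^bsub>M\<^esub> = \<zero>\<^bsub>N\<^esub>"
      "\<And>x y. \<lbrakk>x \<in> carrier M; y \<in> carrier M\<rbrakk> \<Longrightarrow> f (x \<oplus>\<^bsub>M\<^esub> y) = f x \<oplus>\<^bsub>N\<^esub> f y"
  shows "f ([n] \<cdot>\<^bsub>M\<^esub> x) = [n] \<cdot>\<^bsub>N\<^esub> f x"
proof -
  interpret M: abelian_monoid M by fact
  interpret N: abelian_monoid N by fact
  show ?thesis by (induction n) (simp_all add: x f)
qed

lemma linear_maps_restrict:
  assumes "left_semimodule R P" and "f \<in> linear_maps R P M"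
  shows "restrict f (carrier P) \<in> linear_maps R P M"
proof -
  interpret P: left_semimodule R P by fact
  show ?thesis using assms(2) by (auto simp: linear_maps_def P.smult_closed)
qed

lemma linear_maps_pointwise_add:
  assumes "left_semimodule R M" and h: "h \<in> linear_maps R P M" "h' \<in> linear_maps R P M"
  shows "(\<lambda>p. h p \<oplus>\<^bsub>M\<^esub> h' p) \<in> linear_maps R P M"
proof -
  interpret M: left_semimodule R M by fact
  show ?thesis
    by (rule linear_mapsI)
      (use h [THEN linear_maps_closed] in \<open>auto simp: h [THEN linear_maps_add]
        h [THEN linear_maps_smult] M.smult_r_distr M.M.a_ac\<close>)
qed

lemma linear_maps_const_zero:
  assumes "left_semimodule R M"
  shows "(\<lambda>p. \<zero>\<^bsub>M\<^esub>) \<in> linear_maps R P M"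
proof -
  interpret M: left_semimodule R M by fact
  show ?thesis by (rule linear_mapsI) (auto simp: M.smult_zero_right)
qed

lemma linear_maps_add_pow:
  fixes n :: nat
  assumes "left_semimodule R M" and h: "h \<in> linear_maps R P M"
  shows "(\<lambda>p. [n] \<cdot>\<^bsub>M\<^esub> h p) \<in> linear_maps R P M"
proof -
  interpret M: left_semimodule R M by fact
  show ?thesis
  proof (induction n)
    case 0 show ?case using linear_maps_const_zero [OF assms(1)] by simp
  next
    case (Suc n)
    show ?case using linear_maps_pointwise_add [OF assms(1) Suc h] by simp
  qed
qed

lemma left_semimodule_Hom:
  assumes P: "left_semimodule R P" and M: "left_semimodule R M"
  shows "left_semimodule nat_semiring (Hom_semimodule R P M)"
proof -
  interpret P: left_semimodule R P by fact
  interpret M: left_semimodule R M by fact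
  have cl: "h p \<in> carrier M" if "h \<in> linear_maps R P M" "p \<in> carrier P" for h p
    using that by (rule linear_maps_closed)
  note [intro] = linear_maps_restrict [OF P] linear_maps_pointwise_add [OF M]
    linear_maps_const_zero [OF M] linear_maps_add_pow [OF M]
  have r: "(\<lambda>p\<in>carrier P. F p) \<in> linear_maps R P M" if "F \<in> linear_maps R P M" for F
    using linear_maps_restrict [OF P that] .
  show ?thesis
    by (rule left_semimoduleI, rule semiring_nat_semiring)
      (auto intro!: r [unfolded restrict_def] simp: cl M.M.a_ac fun_eq_iff restrict_def extensional_def
        M.M.add.nat_pow_mult [symmetric] M.M.add.nat_pow_distrib M.M.add.nat_pow_pow mult.commute)
qed

lemma compose_linear:
  assumes P: "left_semimodule R P" and M: "left_semimodule R M" and N: "left_semimodule R N"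
    and f: "f \<in> linear_maps R M N"
  shows "compose (carrier P) f
    \<in> linear_maps nat_semiring (Hom_semimodule R P M) (Hom_semimodule R P N)"
proof -
  interpret P: left_semimodule R P by fact
  interpret M: left_semimodule R M by fact
  interpret N: left_semimodule R N by fact
  have cl: "h p \<in> carrier M" if "h \<in> linear_maps R P M" "p \<in> carrier P" for h p
    using that by (rule linear_maps_closed)
  show ?thesis
  proof (rule linear_mapsI)
    fix h assume "h \<in> carrier (Hom_semimodule R P M)"
    then show "compose (carrier P) f h \<in> carrier (Hom_semimodule R P N)"
      using linear_maps_restrict [OF P linear_maps_comp [OF _ f], of h] by (auto simp: compose_def)
  next
    fix n h assume "h \<in> carrier (Hom_semimodule R P M)"
    moreover have "f ([n] \<cdot>\<^bsub>M\<^esub> x) = [n] \<cdot>\<^bsub>N\<^esub> f x" if "x \<in> carrier M" for x and n :: nat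
      by (rule add_pow_additive [OF M.M.abelian_monoid_axioms N.M.abelian_monoid_axioms that])
        (auto simp: linear_maps_closed [OF f] linear_maps_zero [OF M N f] linear_maps_add [OF f])
    ultimately show "compose (carrier P) f (n \<odot>\<^bsub>Hom_semimodule R P M\<^esub> h)
        = n \<odot>\<^bsub>Hom_semimodule R P N\<^esub> compose (carrier P) f h"
      by (auto simp: compose_def cl fun_eq_iff)
  qed (auto simp: compose_def cl fun_eq_iff linear_maps_add [OF f])
qed

section \<open>The implications between the splitting conditions\<close>

text \<open>Let \<open>Ker g\<close> be generated by \<open>e\<close> with complement \<open>f\<close>.  By \<open>k\<close>-normality, two elements \<open>x\<close>
  and \<open>y\<close> with the same image under \<open>g\<close> become equal after adding elements that \<open>f\<close> annihilates,
  so \<open>x \<otimes> f = y \<otimes> f\<close>.  Hence \<open>g x \<mapsto> x \<otimes> f\<close> is well defined; it is a section of \<open>g\<close>, and composing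
  with it lifts every map into \<open>N\<close>.  The kernel components of two maps with the same image
  witness the \<open>k\<close>-normality of \<open>Hom(P, g)\<close>.\<close>

lemma (in semiring) e_projective_regular:
  fixes P :: "('a, 'p, 'n) module_scheme"
  assumes summand: "\<And>I. \<lbrakk>left_ideal R I; subtractive (regular_semimodule R) I\<rbrakk>
      \<Longrightarrow> direct_summand R I (regular_semimodule R)"
    and P: "left_semimodule R P"
  shows "e_projective TYPE('u) R (regular_semimodule R) P"
  unfolding e_projective_def
proof (intro allI impI)
  fix L N :: "('a, 'u) module" and i g
  let ?S = "regular_semimodule R"
  assume "short_exact R L ?S N i g"
  then have L: "left_semimodule R L" and N: "left_semimodule R N"
    and i: "i \<in> linear_maps R L ?S" and g: "g \<in> linear_maps R ?S N"
    and inj: "inj_on i (carrier L)" and img: "i ` carrier L = a_kernel ?S N g"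
    and surj: "g ` carrier R = carrier N" and kn: "k_normal ?S N g"
    by (auto simp: short_exact_def)
  note S = left_semimodule_regular
  interpret P: left_semimodule R P by fact
  interpret N: left_semimodule R N by fact
  obtain e f where ef: "complementary R e f" and ker: "a_kernel ?S N g = fixed_ideal R e"
    using summand [of "a_kernel ?S N g"] subsemimodule_kernel [OF S N g]
      subtractive_kernel [OF S N g] unfolding left_ideal_def direct_summand_iff_complementary by blast
  note [simp] = complementary_closed [OF ef] complementary_mult [OF ef] complementary_idem [OF ef]
  have right_linear: "(\<lambda>x. x \<otimes> y) \<in> linear_maps R ?S ?S" if "y \<in> carrier R" for y
    by (rule linear_mapsI) (auto simp: that l_distr m_assoc)
  have zf: "k \<otimes> f = \<zero>" if "k \<in> fixed_ideal R e" for k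
    using that by (simp add: fixed_ideal_iff [OF ef])
  have key: "x \<otimes> f = y \<otimes> f" if xy: "x \<in> carrier R" "y \<in> carrier R" "g x = g y" for x y
  proof -
    obtain k k' where k: "k \<in> fixed_ideal R e" "k' \<in> fixed_ideal R e" "x \<oplus> k = y \<oplus> k'"
      using kn xy unfolding k_normal_def ker regular_semimodule_simps by blast
    then have kc: "k \<in> carrier R" "k' \<in> carrier R" by (auto simp: fixed_ideal_def)
    have "(x \<oplus> k) \<otimes> f = (y \<oplus> k') \<otimes> f" by (simp only: k)
    then show ?thesis using xy(1,2) kc k(1,2) by (simp add: l_distr zf)
  qed
  have lin: "(\<lambda>x. x \<otimes> f) \<in> linear_maps R ?S ?S" by (rule right_linear) simp
  obtain s where s: "s \<in> linear_maps R N ?S" and sg: "\<And>x. x \<in> carrier R \<Longrightarrow> s (g x) = x \<otimes> f"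
    by (rule linear_maps_factor [OF S g _ lin]) (auto simp: surj intro: key)
  have gs: "g (s y) = y" if y: "y \<in> carrier N" for y
  proof -
    obtain x where x: "x \<in> carrier R" "y = g x" using surj y by auto
    have "x \<otimes> e \<in> a_kernel ?S N g" using x by (simp add: ker fixed_ideal_def m_assoc)
    then have ge: "g (x \<otimes> e) = \<zero>\<^bsub>N\<^esub>" by (simp add: mem_a_kernel)
    have "g (s y) = \<zero>\<^bsub>N\<^esub> \<oplus>\<^bsub>N\<^esub> g (x \<otimes> f)"
      using x linear_maps_closed [OF g, of "x \<otimes> f"] by (simp add: sg)
    also have "\<dots> = g (x \<otimes> e \<oplus> x \<otimes> f)"
      using linear_maps_add [OF g, of "x \<otimes> e" "x \<otimes> f"] x ge by simp
    also have "\<dots> = y" using x by (simp only: complementary_split(1) [OF ef])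
    finally show ?thesis .
  qed
  let ?H = "Hom_semimodule R P"
  have kerH: "h \<in> a_kernel (?H ?S) (?H N) (compose (carrier P) g) \<longleftrightarrow>
      h \<in> carrier (?H ?S) \<and> (\<forall>p\<in>carrier P. h p \<in> fixed_ideal R e)" for h
  proof (cases "h \<in> carrier (?H ?S)")
    case True
    then have "h p \<in> carrier R" if "p \<in> carrier P" for p
      using that linear_maps_closed [of h R P ?S] by auto
    then have "(\<forall>p\<in>carrier P. h p \<in> fixed_ideal R e) \<longleftrightarrow> (\<forall>p\<in>carrier P. g (h p) = \<zero>\<^bsub>N\<^esub>)"
      unfolding ker [symmetric] mem_a_kernel by simp
    moreover have "compose (carrier P) g h = \<zero>\<^bsub>?H N\<^esub> \<longleftrightarrow> (\<forall>p\<in>carrier P. g (h p) = \<zero>\<^bsub>N\<^esub>)"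
      by (auto simp: compose_def fun_eq_iff)
    ultimately show ?thesis
      unfolding mem_a_kernel using True by blast
  qed (unfold mem_a_kernel, blast)
  show "short_exact nat_semiring (?H L) (?H ?S) (?H N) (compose (carrier P) i) (compose (carrier P) g)"
    unfolding short_exact_def
  proof (intro conjI)
    show "inj_on (compose (carrier P) i) (carrier (?H L))"
    proof (rule inj_onI)
      fix h h' assume h: "h \<in> carrier (?H L)" "h' \<in> carrier (?H L)"
        and eq: "compose (carrier P) i h = compose (carrier P) i h'"
      have "h p = h' p" if p: "p \<in> carrier P" for p
      proof (rule inj_onD [OF inj])
        show "i (h p) = i (h' p)" using fun_cong [OF eq, of p] p by (simp add: compose_def)
        show "h p \<in> carrier L" "h' p \<in> carrier L"
          using h p linear_maps_closed [of _ R P L] by auto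
      qed
      with h show "h = h'" by (auto intro: extensionalityI)
    qed
    show "compose (carrier P) i ` carrier (?H L) = a_kernel (?H ?S) (?H N) (compose (carrier P) g)"
    proof (intro subset_antisym subsetI)
      fix h assume "h \<in> compose (carrier P) i ` carrier (?H L)"
      then obtain h' where h': "h' \<in> carrier (?H L)" "h = compose (carrier P) i h'" by blast
      then have "h \<in> carrier (?H ?S)"
        using linear_maps_closed [OF compose_linear [OF P L S i]] by blast
      moreover have "h p \<in> fixed_ideal R e" if "p \<in> carrier P" for p
      proof -
        have "h' p \<in> carrier L" using h' that linear_maps_closed [of h' R P L] by auto
        then show ?thesis using h'(2) that img ker by (auto simp: compose_def)
      qed
      ultimately show "h \<in> a_kernel (?H ?S) (?H N) (compose (carrier P) g)"
        unfolding kerH by blast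
    next
      fix h assume "h \<in> a_kernel (?H ?S) (?H N) (compose (carrier P) g)"
      then have h: "h \<in> linear_maps R P ?S" "h \<in> extensional (carrier P)"
        and hk: "\<And>p. p \<in> carrier P \<Longrightarrow> h p \<in> i ` carrier L"
        unfolding kerH img ker by auto
      define h' where "h' = (\<lambda>p\<in>carrier P. inv_into (carrier L) i (h p))"
      have ih: "i (h' p) = h p" "h' p \<in> carrier L" if "p \<in> carrier P" for p
        using hk [OF that] that by (auto simp: h'_def f_inv_into_f inv_into_into)
      interpret L: left_semimodule R L by fact
      have "h' \<in> linear_maps R P L"
      proof (rule linear_mapsI)
        fix p p' assume "p \<in> carrier P" "p' \<in> carrier P"
        then show "h' (p \<oplus>\<^bsub>P\<^esub> p') = h' p \<oplus>\<^bsub>L\<^esub> h' p'"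
          by (intro inj_onD [OF inj]) (auto simp: ih linear_maps_add [OF i] linear_maps_add [OF h(1)])
      next
        fix a p assume "a \<in> carrier R" "p \<in> carrier P"
        then show "h' (a \<odot>\<^bsub>P\<^esub> p) = a \<odot>\<^bsub>L\<^esub> h' p"
          by (intro inj_onD [OF inj])
            (auto simp: ih linear_maps_smult [OF i] linear_maps_smult [OF h(1)] P.smult_closed
              L.smult_closed)
      qed (rule ih)
      moreover have "h = compose (carrier P) i h'"
        by (rule extensionalityI [OF h(2)]) (auto simp: compose_def ih)
      moreover have "h' \<in> extensional (carrier P)" unfolding h'_def by simp
      ultimately show "h \<in> compose (carrier P) i ` carrier (?H L)"
        unfolding Hom_semimodule_simps by blast
    qed
    show "compose (carrier P) g ` carrier (?H ?S) = carrier (?H N)"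
    proof (intro subset_antisym subsetI)
      fix h assume "h \<in> compose (carrier P) g ` carrier (?H ?S)"
      then show "h \<in> carrier (?H N)"
        using linear_maps_closed [OF compose_linear [OF P S N g]] by blast
    next
      fix h assume h: "h \<in> carrier (?H N)"
      then have "compose (carrier P) s h \<in> carrier (?H ?S)"
        using linear_maps_closed [OF compose_linear [OF P N S s]] by blast
      moreover have "h = compose (carrier P) g (compose (carrier P) s h)"
        by (rule extensionalityI [where A = "carrier P"])
          (use h linear_maps_closed [of h R P N] in \<open>auto simp: compose_def gs\<close>)
      ultimately show "h \<in> compose (carrier P) g ` carrier (?H ?S)" by blast
    qed
    show "k_normal (?H ?S) (?H N) (compose (carrier P) g)"
      unfolding k_normal_def
    proof (intro ballI impI)
      fix h h' assume h: "h \<in> carrier (?H ?S)" "h' \<in> carrier (?H ?S)"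
        and eq: "compose (carrier P) g h = compose (carrier P) g h'"
      (* h = h e + h f and h' = h' e + h' f with h f = h' f, so h + h' e = h' + h e. *)
      define E where "E = compose (carrier P) (\<lambda>x. x \<otimes> e)"
      have E: "E k \<in> a_kernel (?H ?S) (?H N) (compose (carrier P) g)" if k: "k \<in> carrier (?H ?S)" for k
        unfolding kerH
      proof
        have "(\<lambda>x. x \<otimes> e) \<in> linear_maps R ?S ?S" by (rule right_linear) simp
        from linear_maps_closed [OF compose_linear [OF P S S this] k]
        show "E k \<in> carrier (?H ?S)" unfolding E_def .
        show "\<forall>p\<in>carrier P. E k p \<in> fixed_ideal R e"
          using k linear_maps_closed [of k R P ?S]
          by (auto simp: E_def compose_def fixed_ideal_def m_assoc)
      qed
      have "h p \<oplus> E h' p = h' p \<oplus> E h p" if p: "p \<in> carrier P" for p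
      proof -
        have c: "h p \<in> carrier R" "h' p \<in> carrier R"
          using h p linear_maps_closed [of _ R P ?S] by auto
        have "g (h p) = g (h' p)" using fun_cong [OF eq, of p] p by (simp add: compose_def)
        then have f: "h p \<otimes> f = h' p \<otimes> f" using c by (intro key)
        have "h p \<oplus> E h' p = (h p \<otimes> e \<oplus> h p \<otimes> f) \<oplus> h' p \<otimes> e"
          using c p by (simp add: complementary_split [OF ef] E_def compose_def)
        also have "\<dots> = (h' p \<otimes> e \<oplus> h' p \<otimes> f) \<oplus> h p \<otimes> e"
          unfolding f using c by (simp add: a_ac)
        also have "\<dots> = h' p \<oplus> E h p"
          using c p by (simp add: complementary_split [OF ef] E_def compose_def)
        finally show ?thesis .
      qed
      then have "h \<oplus>\<^bsub>?H ?S\<^esub> E h' = h' \<oplus>\<^bsub>?H ?S\<^esub> E h" by (auto simp: fun_eq_iff)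
      then show "\<exists>k\<in>a_kernel (?H ?S) (?H N) (compose (carrier P) g).
          \<exists>k'\<in>a_kernel (?H ?S) (?H N) (compose (carrier P) g).
            h \<oplus>\<^bsub>?H ?S\<^esub> k = h' \<oplus>\<^bsub>?H ?S\<^esub> k'"
        using E h by blast
    qed
  qed (rule left_semimodule_Hom [OF P L] left_semimodule_Hom [OF P S] left_semimodule_Hom [OF P N]
      compose_linear [OF P L S i] compose_linear [OF P S N g])+
qed

text \<open>A normal surjection is the second map of an exact sequence starting with its kernel;
  surjectivity of \<open>Hom(P, f)\<close> is the lifting property.\<close>

lemma k_projective_if_e_projective:
  fixes M :: "('a, 'b, 'm) module_scheme" and j :: "'b \<Rightarrow> 'u"
  assumes M: "left_semimodule R M" and P: "left_semimodule R P" and j: "inj j"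
    and ep: "e_projective TYPE('u) R M P"
  shows "k_projective TYPE('u) R M P"
  unfolding k_projective_def
proof (intro allI impI)
  fix N :: "('a, 'u) module" and f g
  assume asm: "left_semimodule R N \<and> f \<in> linear_maps R M N \<and> normal_map M N f \<and>
    f ` carrier M = carrier N \<and> g \<in> linear_maps R P N"
  then have "short_exact R (transport j (M\<lparr>carrier := a_kernel M N f\<rparr>)) M N
      (inv_into (carrier (M\<lparr>carrier := a_kernel M N f\<rparr>)) j) f"
    by (intro short_exact_kernel M) (auto simp: normal_map_def intro: inj_on_subset [OF j])
  then have img: "compose (carrier P) f ` carrier (Hom_semimodule R P M)
      = carrier (Hom_semimodule R P N)"
    using ep unfolding e_projective_def short_exact_def [of nat_semiring] by blast
  have "restrict g (carrier P) \<in> carrier (Hom_semimodule R P N)"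
    using asm linear_maps_restrict [OF P] by auto
  then obtain h where h: "h \<in> carrier (Hom_semimodule R P M)"
    "restrict g (carrier P) = compose (carrier P) f h"
    unfolding img [symmetric] by blast
  have "f (h p) = g p" if "p \<in> carrier P" for p
    using fun_cong [OF h(2), of p] that by (simp add: compose_def)
  then show "\<exists>h\<in>linear_maps R P M. \<forall>p\<in>carrier P. f (h p) = g p"
    using h by auto
qed

text \<open>As \<open>j\<close> is an isomorphism, liftings pass from the copy to \<open>P\<close>.  This brings \<open>S/I\<close>, whose
  elements are sets, within reach of a hypothesis on all semimodules over another type.\<close>

lemma k_projective_transport:
  assumes P: "left_semimodule R P" and j: "inj_on j (carrier P)"
    and kp: "k_projective TYPE('u) R M (transport j P)"
  shows "k_projective TYPE('u) R M P"
  unfolding k_projective_def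
proof (intro allI impI)
  fix N :: "('a, 'u) module" and f g
  assume asm: "left_semimodule R N \<and> f \<in> linear_maps R M N \<and> normal_map M N f \<and>
    f ` carrier M = carrier N \<and> g \<in> linear_maps R P N"
  then have gP: "g \<in> linear_maps R P N" by blast
  let ?g = "\<lambda>x. g (inv_into (carrier P) j x)"
  have "?g \<in> linear_maps R (transport j P) N"
    by (rule linear_maps_comp [OF transport_inv_linear [OF P j] gP])
  then have "\<exists>h\<in>linear_maps R (transport j P) M. \<forall>x\<in>carrier (transport j P). f (h x) = ?g x"
    using asm by (intro kp [unfolded k_projective_def, rule_format, of N f ?g]) simp
  then obtain h where h: "h \<in> linear_maps R (transport j P) M"
    "\<And>x. x \<in> carrier (transport j P) \<Longrightarrow> f (h x) = ?g x"
    by blast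
  have "(\<lambda>p. h (j p)) \<in> linear_maps R P M"
    using linear_maps_comp [OF transport_linear [OF P j] h(1)] .
  moreover have "f (h (j p)) = g p" if "p \<in> carrier P" for p
    using h(2) that j by simp
  ultimately show "\<exists>h\<in>linear_maps R P M. \<forall>p\<in>carrier P. f (h p) = g p"
    by (intro bexI [of _ "\<lambda>p. h (j p)"]) auto
qed

text \<open>\<open>N\<close> is a copy of \<open>M/Ker g\<close>, so lifting \<open>M/Ker g \<rightarrow> N\<close> along \<open>g\<close> gives the section.\<close>

lemma right_splits_if_quotient_k_projective:
  fixes N :: "('a, 'u) module"
  assumes M: "left_semimodule R M" and N: "left_semimodule R N"
    and g: "g \<in> linear_maps R M N" and surj: "g ` carrier M = carrier N" and kn: "k_normal M N g"
    and kp: "k_projective TYPE('u) R M (quotient_semimodule M (a_kernel M N g))"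
  shows "right_splits R M N g"
proof -
  interpret M: left_semimodule R M by fact
  interpret N: left_semimodule R N by fact
  let ?K = "a_kernel M N g"
  let ?Q = "quotient_semimodule M ?K"
  define q where "q = (\<lambda>x. quotient_rel M ?K `` {x})"
  note K = subsemimodule_kernel [OF M N g]
  note q = M.quotient_proj_linear [OF K, folded q_def] M.quotient_proj_surj [OF K, folded q_def]
  have eq: "q x = q y \<longleftrightarrow> g x = g y" if xy: "x \<in> carrier M" "y \<in> carrier M" for x y
  proof
    assume "q x = q y"
    then obtain k k' where k: "k \<in> ?K" "k' \<in> ?K" "x \<oplus>\<^bsub>M\<^esub> k = y \<oplus>\<^bsub>M\<^esub> k'"
      using M.quotient_proj_eq_iff [OF K xy] unfolding q_def by blast
    then have "g x \<oplus>\<^bsub>N\<^esub> g k = g y \<oplus>\<^bsub>N\<^esub> g k'"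
      using linear_maps_add [OF g] xy by (metis mem_a_kernel)
    then show "g x = g y" using k xy linear_maps_closed [OF g] by (simp add: mem_a_kernel)
  next
    assume "g x = g y"
    then show "q x = q y"
      using kn xy M.quotient_proj_eq_iff [OF K xy] unfolding q_def k_normal_def by blast
  qed
  obtain gq where gq: "gq \<in> linear_maps R ?Q N" "\<And>x. x \<in> carrier M \<Longrightarrow> gq (q x) = g x"
    using linear_maps_factor [OF M q g] eq by blast
  obtain qg where qg: "qg \<in> linear_maps R N ?Q" "\<And>x. x \<in> carrier M \<Longrightarrow> qg (g x) = q x"
    using linear_maps_factor [OF M g surj q(1)] eq by blast
  have "normal_map M N g"
    using kn surj by (auto simp: normal_map_def i_normal_def subtractive_closure_def
        intro!: bexI [of _ "\<zero>\<^bsub>N\<^esub>"])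
  then obtain h where h: "h \<in> linear_maps R ?Q M" "\<And>y. y \<in> carrier ?Q \<Longrightarrow> g (h y) = gq y"
    using kp N g surj gq(1) unfolding k_projective_def by blast
  have "g (h (qg y)) = y" if y: "y \<in> carrier N" for y
  proof -
    obtain x where x: "x \<in> carrier M" "y = g x" using surj y by auto
    then show ?thesis using h(2) [of "q x"] q(2) by (auto simp: qg gq)
  qed
  then show ?thesis
    unfolding right_splits_def using linear_maps_comp [OF qg(1) h(1)]
    by (intro bexI [of _ "\<lambda>y. h (qg y)"]) auto
qed

section \<open>Chain conditions and decompositions\<close>

context semiring
begin

lemma subtractive_fixed_ideal:
  assumes ef: "complementary R e f"
  shows "subtractive (regular_semimodule R) (fixed_ideal R e)"
proof -
  have "x \<in> fixed_ideal R e"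
    if "x \<in> carrier R" "l \<in> fixed_ideal R e" "x \<oplus> l \<in> fixed_ideal R e" for x l
    using that by (auto simp: fixed_ideal_iff [OF ef] l_distr complementary_closed [OF ef])
  moreover have "\<exists>l\<in>fixed_ideal R e. x \<oplus> l \<in> fixed_ideal R e" if "x \<in> fixed_ideal R e" for x
    using that by (intro bexI [of _ \<zero>])
      (auto simp: fixed_ideal_iff [OF ef] complementary_closed [OF ef])
  ultimately show ?thesis
    using fixed_ideal_subset_carrier [of e]
    unfolding subtractive_def subtractive_closure_def by fastforce
qed

text \<open>\<open>d\<close> is the image of the class of \<open>\<one>\<close> under a section of \<open>R \<rightarrow> R/I\<close>.  As the section is
  linear, \<open>x \<otimes> d\<close> is the image of the class of \<open>x\<close>.\<close>

lemma annihilated_representative_of_one: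
  fixes \<iota> :: "'a set \<Rightarrow> 'u"
  assumes \<iota>: "inj \<iota>" and I: "left_ideal R I" and sub: "subtractive (regular_semimodule R) I"
    and split: "\<And>(L :: ('a, 'u) module) (N :: ('a, 'u) module) f g.
        short_exact R L (regular_semimodule R) N f g \<Longrightarrow> right_splits R (regular_semimodule R) N g"
  obtains d k k' where "d \<in> carrier R" "k \<in> I" "k' \<in> I" "\<one> \<oplus> k = d \<oplus> k'"
    "\<forall>x\<in>I. x \<otimes> d = \<zero>"
proof -
  let ?S = "regular_semimodule R"
  let ?Q = "quotient_semimodule ?S I"
  define q where "q = (\<lambda>x. quotient_rel ?S I `` {x})"
  note S = left_semimodule_regular
  interpret S: left_semimodule R ?S by (rule S)
  have I': "subsemimodule R I ?S" using I by (simp add: left_ideal_def)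
  have Q: "left_semimodule R ?Q" and q: "q \<in> linear_maps R ?S ?Q" "q ` carrier ?S = carrier ?Q"
    unfolding q_def by (rule S.quotient_facts [OF I'])+
  have eq: "q x = q y \<longleftrightarrow> (\<exists>l\<in>I. \<exists>l'\<in>I. x \<oplus> l = y \<oplus> l')" if "x \<in> carrier R" "y \<in> carrier R" for x y
    using S.quotient_proj_eq_iff [OF I', of x y] that by (simp add: q_def)
  have inj: "inj_on \<iota> (carrier ?Q)" using \<iota> by (rule inj_on_subset) simp
  define N where "N = transport \<iota> ?Q"
  define g where "g = (\<lambda>x. \<iota> (q x))"
  have N: "left_semimodule R N" unfolding N_def by (rule left_semimodule_transport [OF Q inj])
  have g: "g \<in> linear_maps R ?S N"
    unfolding g_def N_def by (rule linear_maps_comp [OF q(1) transport_linear [OF Q inj]])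
  have g_eq: "g x = g y \<longleftrightarrow> q x = q y" for x y
    using \<iota> by (simp add: g_def inj_eq)
  have "a_kernel ?S N g = a_kernel ?S ?Q q"
    using \<iota> by (auto simp: mem_a_kernel g_def N_def inj_eq)
  also have "\<dots> = I" unfolding q_def by (rule kernel_quotient_proj [OF S I' sub])
  finally have ker: "a_kernel ?S N g = I" .
  have "short_exact R (transport (\<lambda>x. \<iota> {x}) (?S\<lparr>carrier := a_kernel ?S N g\<rparr>)) ?S N
      (inv_into (carrier (?S\<lparr>carrier := a_kernel ?S N g\<rparr>)) (\<lambda>x. \<iota> {x})) g"
  proof (rule short_exact_kernel [OF S N g])
    show "g ` carrier ?S = carrier N"
      unfolding g_def N_def transport_simps q(2) [symmetric] by auto
    show "k_normal ?S N g"
      unfolding k_normal_def ker by (simp add: g_eq eq)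
    show "inj_on (\<lambda>x. \<iota> {x}) (a_kernel ?S N g)"
      using \<iota> by (auto simp: inj_on_def dest: injD)
  qed
  from split [OF this] obtain s where s: "s \<in> linear_maps R N ?S" "\<And>y. y \<in> carrier N \<Longrightarrow> g (s y) = y"
    unfolding right_splits_def by blast
  have g1: "g \<one> \<in> carrier N" using linear_maps_closed [OF g, of \<one>] by simp
  define d where "d = s (g \<one>)"
  have d: "d \<in> carrier R" unfolding d_def using linear_maps_closed [OF s(1) g1] by simp
  have "g \<one> = g d" unfolding d_def using s(2) [OF g1] by simp
  then obtain k k' where k: "k \<in> I" "k' \<in> I" "\<one> \<oplus> k = d \<oplus> k'"
    using d by (auto simp: g_eq eq)
  have "x \<otimes> d = \<zero>" if x: "x \<in> I" for x
  proof -
    have xc: "x \<in> carrier R" "g x = \<zero>\<^bsub>N\<^esub>"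
      using x unfolding ker [symmetric] mem_a_kernel by auto
    have "x \<otimes> d = s (x \<odot>\<^bsub>N\<^esub> g \<one>)"
      unfolding d_def using linear_maps_smult [OF s(1) xc(1) g1] by simp
    also have "x \<odot>\<^bsub>N\<^esub> g \<one> = g x"
      using linear_maps_smult [OF g xc(1), of \<one>] xc(1) by simp
    also have "s (g x) = \<zero>" using linear_maps_zero [OF N S s(1)] xc by simp
    finally show ?thesis .
  qed
  then show ?thesis by (intro that [OF d k]) blast
qed

text \<open>The union \<open>I\<close> of the chain is subtractive.  Take \<open>\<one> \<oplus> k = d \<oplus> k'\<close> with \<open>I \<otimes> d = 0\<close>; both
  \<open>k\<close> and \<open>k'\<close> lie in some \<open>N n\<close>, so that multiplying by the complement \<open>f n\<close> gives
  \<open>f n = d \<otimes> f n\<close>.  This complement is therefore annihilated by the whole of \<open>I\<close>.\<close>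

lemma acc_direct_summands_if_right_splits:
  fixes \<iota> :: "'a set \<Rightarrow> 'u"
  assumes \<iota>: "inj \<iota>"
    and split: "\<And>(L :: ('a, 'u) module) (N :: ('a, 'u) module) f g.
        short_exact R L (regular_semimodule R) N f g \<Longrightarrow> right_splits R (regular_semimodule R) N g"
  shows "acc_direct_summands R (regular_semimodule R)"
  unfolding acc_direct_summands_def
proof (intro allI impI)
  let ?S = "regular_semimodule R"
  fix N :: "nat \<Rightarrow> 'a set"
  assume asm: "(\<forall>i. direct_summand R (N i) ?S) \<and> (\<forall>i. N i \<subseteq> N (Suc i))"
  then have "\<forall>i. \<exists>e f. complementary R e f \<and> N i = fixed_ideal R e"
    by (simp add: direct_summand_iff_complementary)
  then obtain e f where ef: "\<And>i. complementary R (e i) (f i)" and N: "\<And>i. N i = fixed_ideal R (e i)"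
    by metis
  have mono: "N i \<subseteq> N j" if "i \<le> j" for i j
    by (rule lift_Suc_mono_le [OF _ that]) (use asm in blast)
  have common: "\<exists>n. x \<in> N n \<and> y \<in> N n" if "x \<in> (\<Union>i. N i)" "y \<in> (\<Union>i. N i)" for x y
    using that mono by (metis UN_E in_mono linorder_le_cases)
  have subN: "subsemimodule R (N i) ?S" for i
    unfolding N using ef by (intro subsemimodule_fixed_ideal complementary_closed)
  have ideal: "left_ideal R (\<Union>i. N i)"
    unfolding left_ideal_def subsemimodule_def
  proof (intro conjI ballI)
    show "(\<Union>i. N i) \<subseteq> carrier ?S" "\<zero>\<^bsub>?S\<^esub> \<in> (\<Union>i. N i)"
      using subN unfolding subsemimodule_def by blast+
  next
    fix x y assume "x \<in> (\<Union>i. N i)" "y \<in> (\<Union>i. N i)"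
    then obtain n where "x \<in> N n" "y \<in> N n" using common by blast
    then show "x \<oplus>\<^bsub>?S\<^esub> y \<in> (\<Union>i. N i)"
      using subN [of n] unfolding subsemimodule_def by blast
  next
    fix a x assume "a \<in> carrier R" "x \<in> (\<Union>i. N i)"
    then show "a \<odot>\<^bsub>?S\<^esub> x \<in> (\<Union>i. N i)"
      using subN unfolding subsemimodule_def by blast
  qed
  have sub: "subtractive ?S (\<Union>i. N i)"
    unfolding subtractive_def
  proof (intro subset_antisym subsetI)
    fix x assume "x \<in> (\<Union>i. N i)"
    then obtain n where "x \<in> subtractive_closure ?S (N n)"
      using subtractive_fixed_ideal [OF ef] unfolding N subtractive_def by blast
    then show "x \<in> subtractive_closure ?S (\<Union>i. N i)"
      unfolding subtractive_closure_def by blast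
  next
    fix x assume "x \<in> subtractive_closure ?S (\<Union>i. N i)"
    then obtain l l' where "x \<in> carrier ?S" "x \<oplus>\<^bsub>?S\<^esub> l = l'" "l \<in> (\<Union>i. N i)" "l' \<in> (\<Union>i. N i)"
      unfolding subtractive_closure_def by blast
    moreover from this(3,4) obtain n where "l \<in> N n" "l' \<in> N n" using common by blast
    ultimately have "x \<in> subtractive_closure ?S (N n)"
      unfolding subtractive_closure_def by blast
    then show "x \<in> (\<Union>i. N i)"
      using subtractive_fixed_ideal [OF ef] unfolding N subtractive_def by blast
  qed
  obtain d k k' where d: "d \<in> carrier R" and k: "k \<in> (\<Union>i. N i)" "k' \<in> (\<Union>i. N i)"
    and one: "\<one> \<oplus> k = d \<oplus> k'" and ann: "\<forall>x\<in>\<Union>i. N i. x \<otimes> d = \<zero>"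
    by (rule annihilated_representative_of_one [OF \<iota> ideal sub split])
  obtain n where n: "k \<in> N n" "k' \<in> N n" using common k by blast
  then have kf: "k \<in> carrier R" "k' \<in> carrier R" "k \<otimes> f n = \<zero>" "k' \<otimes> f n = \<zero>"
    unfolding N by (auto simp: fixed_ideal_iff [OF ef])
  have fc: "f n \<in> carrier R" using ef by (rule complementary_closed)
  have "(\<one> \<oplus> k) \<otimes> f n = (d \<oplus> k') \<otimes> f n" by (simp only: one)
  then have df: "f n = d \<otimes> f n" using kf(1,2) fc d by (simp add: l_distr kf(3,4))
  have "N i \<subseteq> N n" for i
  proof
    fix x assume x: "x \<in> N i"
    then have xc: "x \<in> carrier R" unfolding N by (auto simp: fixed_ideal_def)
    have "x \<otimes> f n = x \<otimes> (d \<otimes> f n)" using df by simp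
    also have "\<dots> = (x \<otimes> d) \<otimes> f n" using xc d fc by (simp add: m_assoc)
    also have "\<dots> = \<zero>" using ann x fc by auto
    finally show "x \<in> N n" using xc by (simp add: N fixed_ideal_iff [OF ef])
  qed
  then show "\<exists>n. \<forall>i\<ge>n. N i = N n" using mono by blast
qed

text \<open>Complements of a descending chain need not ascend.  Choosing them one after the other, with
  \<open>f \<oplus> e \<otimes> f'\<close> as the complement that follows \<open>f\<close>, makes them do so.\<close>

lemma dcc_direct_summands_if_acc:
  assumes acc: "acc_direct_summands R (regular_semimodule R)"
  shows "dcc_direct_summands R (regular_semimodule R)"
  unfolding dcc_direct_summands_def
proof (intro allI impI)
  let ?S = "regular_semimodule R"
  fix N :: "nat \<Rightarrow> 'a set"
  assume "(\<forall>i. direct_summand R (N i) ?S) \<and> (\<forall>i. N (Suc i) \<subseteq> N i)"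
  then have summand: "\<And>i. \<exists>e f. complementary R e f \<and> N i = fixed_ideal R e"
    and desc: "\<And>i. N (Suc i) \<subseteq> N i"
    by (auto simp: direct_summand_iff_complementary)
  let ?P = "\<lambda>i p. complementary R (fst p) (snd p) \<and> N i = fixed_ideal R (fst p)"
  have "\<exists>p. \<forall>i. ?P i (p i) \<and> snd (p i) \<otimes> snd (p (Suc i)) = snd (p i)"
  proof (rule dependent_nat_choice [where P = ?P and Q = "\<lambda>_ x y. snd x \<otimes> snd y = snd x"])
    show "\<exists>x. ?P 0 x" using summand [of 0] by auto
  next
    fix x i assume "?P i x"
    then obtain e f where x: "x = (e, f)" and ef: "complementary R e f" and Ni: "N i = fixed_ideal R e"
      by (cases x) auto
    obtain e' f' where ef': "complementary R e' f'" and Ni': "N (Suc i) = fixed_ideal R e'"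
      using summand by blast
    have sub: "fixed_ideal R e' \<subseteq> fixed_ideal R e" using desc [of i] by (simp add: Ni Ni')
    note ref = complementary_refine [OF ef ef' sub]
    have "complementary R (e \<otimes> e') (e \<otimes> f' \<oplus> f)"
      by (rule complementary_corner [OF ef]) (rule ref)+
    moreover have "f \<otimes> (e \<otimes> f' \<oplus> f) = f"
    proof -
      have "f \<otimes> (e \<otimes> f') = \<zero>"
        using m_assoc [of f e f'] by (simp add: complementary_closed [OF ef]
            complementary_closed [OF ef'] complementary_mult [OF ef])
      then show ?thesis
        by (simp add: r_distr ref complementary_closed [OF ef] complementary_idem [OF ef])
    qed
    ultimately show "\<exists>y. ?P (Suc i) y \<and> snd x \<otimes> snd y = snd x"
      by (intro exI [of _ "(e \<otimes> e', e \<otimes> f' \<oplus> f)"]) (simp add: x Ni' ref)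
  qed
  then obtain p where p: "\<And>i. ?P i (p i)"
    and step: "\<And>i. snd (p i) \<otimes> snd (p (Suc i)) = snd (p i)"
    by blast
  define e where "e = (\<lambda>i. fst (p i))"
  define f where "f = (\<lambda>i. snd (p i))"
  have ef: "complementary R (e i) (f i)" and N: "N i = fixed_ideal R (e i)"
    and ff: "f i \<otimes> f (Suc i) = f i" for i
    using p step by (auto simp: e_def f_def)
  have "direct_summand R (fixed_ideal R (f i)) ?S" for i
    using ef complementary_sym direct_summand_iff_complementary by blast
  moreover have "fixed_ideal R (f i) \<subseteq> fixed_ideal R (f (Suc i))" for i
    by (rule fixed_ideal_mono [OF ff]) (rule complementary_closed [OF ef])+
  ultimately obtain n where n: "\<And>i. i \<ge> n \<Longrightarrow> fixed_ideal R (f i) = fixed_ideal R (f n)"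
    using acc [unfolded acc_direct_summands_def, rule_format, of "\<lambda>i. fixed_ideal R (f i)"] by blast
  have antimono: "N j \<subseteq> N i" if "i \<le> j" for i j
    using that by (induction rule: dec_induct) (use desc in blast)+
  have "N n \<subseteq> N i" if i: "i \<ge> n" for i
  proof -
    note [simp] = complementary_closed [OF ef] complementary_mult [OF ef] complementary_idem [OF ef]
    have "f i \<in> fixed_ideal R (f n)"
      using n [OF i] complementary_mem [OF complementary_sym [OF ef]] by blast
    then have "f i \<otimes> e n = \<zero>"
      by (simp add: fixed_ideal_iff [OF complementary_sym [OF ef]])
    then have fe: "(e n \<otimes> f i) \<otimes> e n = \<zero>" by (simp add: m_assoc)
    have "e i \<in> fixed_ideal R (e n)"
      using antimono [OF i] complementary_mem [OF ef] unfolding N by blast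
    then have "e i \<otimes> e n = e i" by (simp add: fixed_ideal_def)
    then have ee: "(e n \<otimes> e i) \<otimes> e n = e n \<otimes> e i" by (simp add: m_assoc)
    have "e n = (e n \<otimes> e i \<oplus> e n \<otimes> f i) \<otimes> e n"
      by (simp add: complementary_split [OF ef])
    also have "\<dots> = e n \<otimes> e i" by (simp only: l_distr m_closed complementary_closed [OF ef] fe ee) simp
    finally show ?thesis
      unfolding N by (intro fixed_ideal_mono) simp_all
  qed
  then show "\<exists>n. \<forall>i\<ge>n. N i = N n" using antimono by blast
qed

text \<open>A summand of \<open>fixed_ideal R e\<close> is a summand of the whole semiring, so minimality among the
  latter suffices.\<close>

lemma irreducible_summand_if_minimal:
  assumes ef: "complementary R e f" and nz: "fixed_ideal R e \<noteq> {\<zero>}"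
    and min: "\<And>L. \<lbrakk>direct_summand R L (regular_semimodule R); L \<noteq> {\<zero>}; L \<subseteq> fixed_ideal R e\<rbrakk>
      \<Longrightarrow> L = fixed_ideal R e"
  shows "irreducible_summand R (fixed_ideal R e) (regular_semimodule R)"
proof -
  let ?T = "(regular_semimodule R)\<lparr>carrier := fixed_ideal R e\<rparr>"
  note ec = complementary_closed [OF ef] and ee = complementary_idem [OF ef]
  have am: "abelian_monoid ?T" by (rule abelian_monoid_corner [OF ec(1)])
  have z: "subsemimodule R {\<zero>} ?T" "subsemimodule R (fixed_ideal R e) ?T"
    using ec subsemimodule_fixed_ideal [OF ec(1)]
    by (auto simp: subsemimodule_def fixed_ideal_iff [OF ef])
  have "direct_summand R {\<zero>} ?T"
    unfolding direct_summand_iff [OF am]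
    by (rule exI [of _ "fixed_ideal R e"]) (use z in \<open>auto simp: fixed_ideal_def\<close>)
  moreover have "L = {\<zero>} \<or> L = fixed_ideal R e" if L: "direct_summand R L ?T" for L
  proof -
    obtain a b where ab: "a \<in> carrier R" "b \<in> carrier R" "a \<oplus> b = e" "a \<otimes> b = \<zero>" "b \<otimes> a = \<zero>"
      "a \<otimes> e = a" "L = fixed_ideal R a"
      using direct_summand_corner [OF ec(1) ee(1) L] .
    have "complementary R a (b \<oplus> f)" by (rule complementary_corner [OF ef]) (rule ab)+
    then have "direct_summand R L (regular_semimodule R)"
      using ab(7) direct_summand_iff_complementary by blast
    moreover have "L \<subseteq> fixed_ideal R e"
      unfolding ab(7) using ab ec by (intro fixed_ideal_mono)
    ultimately show ?thesis using min by blast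
  qed
  moreover have "direct_summand R (fixed_ideal R e) (regular_semimodule R)"
    using ef direct_summand_iff_complementary by blast
  ultimately show ?thesis
    using nz unfolding irreducible_summand_def maximal_summand_def by auto
qed

text \<open>By well-founded induction on the summand generated by \<open>e\<close>: split off a minimal nonzero
  summand \<open>T\<close> inside it, so that \<open>e = t \<oplus> u\<close> orthogonally, and decompose \<open>u\<close>.  Working with
  families of orthogonal idempotents that sum to \<open>e\<close> avoids direct sums inside varying
  modules.\<close>

lemma irreducible_decomposition:
  assumes dcc: "dcc_direct_summands R (regular_semimodule R)"
  shows "\<exists>(n::nat) T. is_direct_sum R (regular_semimodule R) {1..n} T \<and>
    (\<forall>i\<in>{1..n}. irreducible_summand R (T i) (regular_semimodule R))"
proof -
  let ?S = "regular_semimodule R"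
  define r where "r = {(L, N). direct_summand R L ?S \<and> direct_summand R N ?S \<and> L \<subset> N}"
  have wf: "wf r"
    unfolding wf_iff_no_infinite_down_chain
  proof
    assume "\<exists>N. \<forall>i. (N (Suc i), N i) \<in> r"
    then obtain N where "\<And>i. (N (Suc i), N i) \<in> r" by blast
    then have N: "\<And>i. direct_summand R (N i) ?S" "\<And>i. N (Suc i) \<subset> N i" by (auto simp: r_def)
    have "\<exists>n. \<forall>i\<ge>n. N i = N n"
      using dcc N psubset_imp_subset [OF N(2)] by (simp add: dcc_direct_summands_def)
    then obtain n where n: "\<forall>i\<ge>n. N i = N n" ..
    have "N (Suc n) = N n" by (rule n [rule_format]) simp
    with N(2) [of n] show False by blast
  qed
  let ?dec = "\<lambda>e (n::nat) a. a \<in> {1..n} \<rightarrow> carrier R \<and> finsum R a {1..n} = e \<and>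
     (\<forall>i\<in>{1..n}. a i \<otimes> a i = a i \<and> irreducible_summand R (fixed_ideal R (a i)) ?S) \<and>
     (\<forall>i\<in>{1..n}. \<forall>j\<in>{1..n}. i \<noteq> j \<longrightarrow> a i \<otimes> a j = \<zero>)"
  have main: "\<exists>n a. ?dec e n a" if "complementary R e f" "N = fixed_ideal R e" for e f N
    using wf that
  proof (induction N arbitrary: e f rule: wf_induct_rule)
    case (less N)
    note ef = less.prems(1)
    note [simp] = complementary_closed [OF ef] complementary_mult [OF ef] complementary_idem [OF ef]
    show ?case
    proof (cases "N = {\<zero>}")
      case True
      then have "e = \<zero>" using complementary_mem [OF ef] less.prems(2) by auto
      then show ?thesis by (intro exI [of _ 0] exI [of _ "\<lambda>_. \<zero>"]) simp
    next
      case False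
      have "direct_summand R N ?S"
        using less.prems direct_summand_iff_complementary by blast
      then have "N \<in> {L. direct_summand R L ?S \<and> L \<noteq> {\<zero>} \<and> L \<subseteq> N}"
        using False by blast
      with wf obtain T where "T \<in> {L. direct_summand R L ?S \<and> L \<noteq> {\<zero>} \<and> L \<subseteq> N}"
        and min0: "\<And>L. (L, T) \<in> r \<Longrightarrow> L \<notin> {L. direct_summand R L ?S \<and> L \<noteq> {\<zero>} \<and> L \<subseteq> N}"
        by (rule wfE_min) blast
      then have T: "direct_summand R T ?S" "T \<noteq> {\<zero>}" "T \<subseteq> N" by blast+
      have min: "L = T" if "direct_summand R L ?S" "L \<noteq> {\<zero>}" "L \<subseteq> T" for L
        using min0 [of L] that T unfolding r_def by blast
      obtain e' f' where ef': "complementary R e' f'" and Te': "T = fixed_ideal R e'"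
        using T(1) direct_summand_iff_complementary by blast
      have sub: "fixed_ideal R e' \<subseteq> fixed_ideal R e" using T(3) Te' less.prems(2) by simp
      define t where "t = e \<otimes> e'"
      define u where "u = e \<otimes> f'"
      note ref = complementary_refine [OF ef ef' sub, folded t_def u_def]
      have Tt: "T = fixed_ideal R t" by (simp add: Te' ref)
      have tc: "complementary R t (u \<oplus> f)"
        by (rule complementary_corner [OF ef]) (rule ref)+
      have uc: "complementary R u (t \<oplus> f)"
        by (rule complementary_corner [OF ef]) (use ref in \<open>simp_all add: a_comm\<close>)
      have irr: "irreducible_summand R (fixed_ideal R t) ?S"
        by (rule irreducible_summand_if_minimal [OF tc]) (use T min Tt in auto)
      have "fixed_ideal R u \<subseteq> N"
        unfolding less.prems(2) by (rule fixed_ideal_mono) (simp_all add: ref)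
      moreover have "fixed_ideal R u \<noteq> N"
      proof
        assume "fixed_ideal R u = N"
        then have "t \<in> fixed_ideal R u"
          using complementary_mem [OF tc] T(3) Tt by blast
        then have "t = \<zero>" by (simp add: fixed_ideal_def ref)
        then have "T = {\<zero>}" using Tt by (auto simp: fixed_ideal_def)
        with T(2) show False ..
      qed
      ultimately have "(fixed_ideal R u, N) \<in> r"
        using uc less.prems direct_summand_iff_complementary unfolding r_def by blast
      then obtain n a where a: "?dec u n a"
        using less.IH [OF _ uc] by blast
      then have ac: "a i \<in> carrier R" if "i \<in> {1..n}" for i using that by auto
      (* Each a i is fixed by u on both sides, hence orthogonal to t. *)
      have au: "a j \<otimes> u = a j \<and> u \<otimes> a j = a j" if j: "j \<in> {1..n}" for j
      proof -
        have "a j \<otimes> u = (\<Oplus>i\<in>{1..n}. a j \<otimes> a i)"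
          using a ac j finsum_rdistr [of "{1..n}" "a j" a] by auto
        also have "\<dots> = (\<Oplus>i\<in>{1..n}. if j = i then a i else \<zero>)"
          using a ac j by (intro finsum_cong') auto
        also have "\<dots> = a j" by (rule finsum_singleton) (use ac j in auto)
        finally have 1: "a j \<otimes> u = a j" .
        have "u \<otimes> a j = (\<Oplus>i\<in>{1..n}. a i \<otimes> a j)"
          using a ac j finsum_ldistr [of "{1..n}" "a j" a] by auto
        also have "\<dots> = (\<Oplus>i\<in>{1..n}. if j = i then a i else \<zero>)"
          using a ac j by (intro finsum_cong') auto
        also have "\<dots> = a j" by (rule finsum_singleton) (use ac j in auto)
        finally show ?thesis using 1 by simp
      qed
      have orth: "a j \<otimes> t = \<zero>" "t \<otimes> a j = \<zero>" if j: "j \<in> {1..n}" for j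
        using m_assoc [of "a j" u t] m_assoc [of t u "a j"] au [OF j] ac [OF j] by (auto simp: ref)
      have "finsum R (a(Suc n := t)) {1..Suc n} = t \<oplus> finsum R (a(Suc n := t)) {1..n}"
        using ac ref(1) by (subst atLeastAtMostSuc_conv, simp, subst finsum_insert) auto
      also have "finsum R (a(Suc n := t)) {1..n} = finsum R a {1..n}"
        using ac by (intro finsum_cong') auto
      also have "t \<oplus> finsum R a {1..n} = e" using a ref(3) by simp
      finally have sum: "finsum R (a(Suc n := t)) {1..Suc n} = e" .
      have "?dec e (Suc n) (a(Suc n := t))"
      proof (intro conjI)
        show "a(Suc n := t) \<in> {1..Suc n} \<rightarrow> carrier R"
          using ac ref(1) by (auto simp: le_Suc_eq)
        show "finsum R (a(Suc n := t)) {1..Suc n} = e" by (rule sum)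
        show "\<forall>i\<in>{1..Suc n}. (a(Suc n := t)) i \<otimes> (a(Suc n := t)) i = (a(Suc n := t)) i \<and>
            irreducible_summand R (fixed_ideal R ((a(Suc n := t)) i)) ?S"
          using a irr complementary_idem [OF tc] by (auto simp: le_Suc_eq)
        show "\<forall>i\<in>{1..Suc n}. \<forall>j\<in>{1..Suc n}. i \<noteq> j \<longrightarrow>
            (a(Suc n := t)) i \<otimes> (a(Suc n := t)) j = \<zero>"
          using a orth by (auto simp: le_Suc_eq)
      qed
      then show ?thesis by blast
    qed
  qed
  have "complementary R \<one> \<zero>" by (simp add: complementary_def)
  from main [OF this refl] obtain n a where a: "?dec \<one> n a" by blast
  then have "is_direct_sum R ?S {1..n} (\<lambda>i. fixed_ideal R (a i))"
    by (intro is_direct_sum_fixed_ideals) auto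
  with a show ?thesis by blast
qed

end

(* 'u is the type of the carriers of the semimodules quantified over in the conditions below.
   It is an arbitrary type that is large enough to contain copies of the subsets of S, hence of
   S and of all its quotients. *)
theorem proposition2p19:
  fixes S :: "('a, 'r) ring_scheme" and \<iota> :: "'a set \<Rightarrow> 'u"
  assumes "semiring S" and "\<zero>\<^bsub>S\<^esub> \<noteq> \<one>\<^bsub>S\<^esub>" and "inj \<iota>"
  shows
    "let SS = regular_semimodule S;
         c1 = (\<forall>I. left_ideal S I \<and> subtractive SS I \<longrightarrow> direct_summand S I SS);
         c2 = (\<forall>P :: ('a, 'u) module. left_semimodule S P \<longrightarrow> e_projective TYPE('u) S SS P);
         c3 = (\<forall>P :: ('a, 'u) module. left_semimodule S P \<longrightarrow> k_projective TYPE('u) S SS P);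
         c4 = (\<forall>I. left_ideal S I \<and> subtractive SS I \<longrightarrow>
                 k_projective TYPE('u) S SS (quotient_semimodule SS I));
         c5 = (\<forall>(I :: ('a, 'u) module) (N :: ('a, 'u) module) f g.
                 short_exact S I SS N f g \<longrightarrow> right_splits S SS N g);
         c6 = acc_direct_summands S SS;
         c7 = dcc_direct_summands S SS;
         c8 = (\<exists>(n::nat) T. is_direct_sum S SS {1..n} T \<and>
                 (\<forall>i\<in>{1..n}. irreducible_summand S (T i) SS))
     in (c1 \<longrightarrow> c2) \<and> (c2 \<longrightarrow> c3) \<and> (c3 \<longrightarrow> c4) \<and> (c4 \<longrightarrow> c5) \<and>
        (c5 \<longrightarrow> c6) \<and> (c6 \<longrightarrow> c7) \<and> (c7 \<longrightarrow> c8)"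
proof -
  interpret semiring S by fact
  let ?S = "regular_semimodule S"
  note S = left_semimodule_regular
  interpret S: left_semimodule S ?S by (rule S)
  show ?thesis
    unfolding Let_def
  proof (intro conjI impI allI)
    fix P :: "('a, 'u) module"
    assume "\<forall>I. left_ideal S I \<and> subtractive ?S I \<longrightarrow> direct_summand S I ?S" "left_semimodule S P"
    then show "e_projective TYPE('u) S ?S P" by (intro e_projective_regular) auto
  next
    fix P :: "('a, 'u) module"
    assume *: "\<forall>P :: ('a, 'u) module. left_semimodule S P \<longrightarrow> e_projective TYPE('u) S ?S P"
      and P: "left_semimodule S P"
    have "inj (\<lambda>x. \<iota> {x})" using \<open>inj \<iota>\<close> by (auto simp: inj_on_def)
    then show "k_projective TYPE('u) S ?S P"
      using * P by (intro k_projective_if_e_projective [OF S P]) auto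
  next
    fix I
    assume *: "\<forall>P :: ('a, 'u) module. left_semimodule S P \<longrightarrow> k_projective TYPE('u) S ?S P"
      and I: "left_ideal S I \<and> subtractive ?S I"
    let ?Q = "quotient_semimodule ?S I"
    have Q: "left_semimodule S ?Q"
      using I by (intro S.left_semimodule_quotient) (simp add: left_ideal_def)
    have inj: "inj_on \<iota> (carrier ?Q)" using \<open>inj \<iota>\<close> by (rule inj_on_subset) simp
    show "k_projective TYPE('u) S ?S ?Q"
      using * left_semimodule_transport [OF Q inj] by (intro k_projective_transport [OF Q inj]) auto
  next
    fix I N :: "('a, 'u) module" and f g
    assume *: "\<forall>I. left_ideal S I \<and> subtractive ?S I \<longrightarrow>
        k_projective TYPE('u) S ?S (quotient_semimodule ?S I)"
      and "short_exact S I ?S N f g"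
    then have N: "left_semimodule S N" and g: "g \<in> linear_maps S ?S N"
      "g ` carrier ?S = carrier N" "k_normal ?S N g"
      unfolding short_exact_def by blast+
    have "k_projective TYPE('u) S ?S (quotient_semimodule ?S (a_kernel ?S N g))"
      using * subsemimodule_kernel [OF S N g(1)] subtractive_kernel [OF S N g(1)]
      unfolding left_ideal_def by blast
    then show "right_splits S ?S N g"
      by (rule right_splits_if_quotient_k_projective [OF S N g])
  next
    assume "\<forall>(I :: ('a, 'u) module) (N :: ('a, 'u) module) f g.
      short_exact S I ?S N f g \<longrightarrow> right_splits S ?S N g"
    then show "acc_direct_summands S ?S"
      by (intro acc_direct_summands_if_right_splits [OF \<open>inj \<iota>\<close>]) blast
  next
    assume "acc_direct_summands S ?S"
    then show "dcc_direct_summands S ?S" by (rule dcc_direct_summands_if_acc)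
  next
    assume "dcc_direct_summands S ?S"
    then show "\<exists>(n::nat) T. is_direct_sum S ?S {1..n} T \<and>
        (\<forall>i\<in>{1..n}. irreducible_summand S (T i) ?S)"
      by (rule irreducible_decomposition)
  qed
qed

end
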